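(* Let $\lambda_1$ and $\lambda_2$ be distinct algebraic eigenvalues of $A\in\mathbb{R}_{\max}^{n\times n}$. Then $W(A,\lambda_1)\cap W(A,\lambda_2)=\{\mathcal{E}\}$.
   Context: Max-plus algebra: $\mathbb{R}_{\max}=\mathbb{R}\cup\{\varepsilon\}$, $\varepsilon=-\infty$, $a\oplus b=\max\{a,b\}$, $a\otimes b=a+b$, $e=0$; operations extend to vectors and matrices as usual. $\mathcal{E}$ is the vector with all entries $\varepsilon$; $E_n$ is the max-plus unit matrix (diagonal $0$, off-diagonal $\varepsilon$). $\det A=\bigoplus_{\pi\in S_n}\bigotimes_i a_{i\pi(i)}$. The characteristic polynomial is $\chi_A(t)=\det(A\oplus t\otimes E_n)$; as a function on $\mathbb{R}_{\max}$ it factorizes as $\bigotimes_i (t\oplus r_i)^{\otimes p_i}$ with distinct $r_i\in\mathbb{R}_{\max}$, $p_i\ge1$, $\sum p_i=n$; the roots $r_i$ are called the algebraic eigenvalues of $A$. The sum of subspaces $U_k$ of $\mathbb{R}_{\max}^n$ is $\bigoplus_k U_k=\{\bigoplus_k \bm{x}_k : \bm{x}_k\in U_k\}$. Graphs: $G(A)$ is the weighted digraph on $\{1,\dots,n\}$ with an edge $(i,j)$ of weight $a_{ij}$ whenever $a_{ij}\ne\varepsilon$. A multi-circuit is a (possibly empty) union of disjoint elementary circuits (loops allowed), with length $\ell$ (number of edges) and weight $w$ (sum of edge weights); $V(\mathcal{C})$, $E(\mathcal{C})$ are its vertex and edge sets. For $\lambda\in\mathbb{R}$, $\mathcal{C}$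 is $\lambda$-maximal if $\chi_A(\lambda)=w(\mathcal{C})\otimes\lambda^{\otimes(n-\ell(\mathcal{C}))}$; it is $\varepsilon$-maximal if it is $\mu$-maximal for all sufficiently small (very negative) real $\mu$. For a multi-circuit $\mathcal{C}$: $A_{\mathcal{C}}$ has entry $a_{ij}$ if $(i,j)\in E(\mathcal{C})$ and $\varepsilon$ otherwise; $A_{\setminus\mathcal{C}}$ has entry $\varepsilon$ if $(i,j)\in E(\mathcal{C})$ and $a_{ij}$ otherwise; $E_{\mathcal{C}}$ (resp. $E_{\setminus\mathcal{C}}$) has $(i,i)$ entry $e$ for $i\in V(\mathcal{C})$ (resp. $i\notin V(\mathcal{C})$) and all other entries $\varepsilon$. $W(A,\lambda,\mathcal{C})$ is the set of $\bm{x}\in\mathbb{R}_{\max}^n$ with $(A_{\setminus\mathcal{C}}\oplus\lambda\otimes E_{\mathcal{C}})\otimes\bm{x}=(A_{\mathcal{C}}\oplus\lambda\otimes E_{\setminus\mathcal{C}})\otimes\bm{x}$. Algebraic eigenspace: a matrix satisfies $(\bigstar)$ if for each $\lambda\in\mathbb{R}_{\max}$ any two distinct $\lambda$-maximal multi-circuits in its graph have different lengths. For $\bm{\zeta}=(\zeta_{ij})\in[0,1]^{n\times n}$ and $\delta>0$ let $[A(\bm{\zeta};\delta)]_{ij}=a_{ij}-\zeta_{ij}\delta$. Let $Z$ be the (nonempty) set of $\bm{\zeta}\in[0,1]^{n\times n}$ for which there is $\delta'>0$ such that $A(\bm{\zeta};\delta)$ satisfies $(\bigstar)$ for all $0<\delta<\delta'$.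 Let $\mathcal{B}(\lambda,r)=[\lambda-r,\lambda+r]$ for $\lambda\in\mathbb{R}$ and $\mathcal{B}(\varepsilon,r)=\{\varepsilon\}$. The algebraic eigenspace of $A$ with respect to $\lambda$ is $$W(A,\lambda)=\bigcap_{\bm{\zeta}\in Z}\lim_{\delta\to+0}\bigoplus_{\lambda'\in\mathcal{B}(\lambda,n\delta)}W(A(\bm{\zeta};\delta),\lambda',\mathcal{C}_{\lambda'}(\bm{\zeta};\delta)),$$ where $\mathcal{C}_{\lambda'}(\bm{\zeta};\delta)$ is any $\lambda'$-maximal multi-circuit in $G(A(\bm{\zeta};\delta))$ (for small $\delta$ the space does not depend on this choice, and only finitely many $\lambda'$, the roots of $\chi_{A(\bm{\zeta};\delta)}$, give a space other than $\{\mathcal{E}\}$, so the sum is finite). Here $\lim_{\delta\to+0}S(\delta)$ is the set of $\bm{x}\in\mathbb{R}_{\max}^n$ for which there are $\bm{x}(\delta)\in S(\delta)$ with $\lim_{\delta\to+0}\bm{x}(\delta)=\bm{x}$ (usual topology of $\mathbb{R}\cup\{-\infty\}$). *)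

theory Defs
  imports "HOL-Analysis.Analysis" "Graph_Theory.Arc_Walk"
begin

section \<open>Max-plus linear algebra\<close>

text \<open>
  The max-plus semiring is realised inside \<^typ>\<open>ereal\<close> as the extended reals other than
  \<^term>\<open>\<infinity> :: ereal\<close>: epsilon is \<^term>\<open>-\<infinity> :: ereal\<close>, the unit e is \<^term>\<open>0 :: ereal\<close>,
  max-plus addition is \<^const>\<open>max\<close> (over a finite family: the supremum, which is attained, and
  is epsilon for the empty family), and max-plus multiplication is \<^term>\<open>(+)\<close>.  The topology
  of \<^typ>\<open>ereal\<close> induces the usual topology on the reals extended by minus infinity.
\<close>

definition rmax :: "ereal set" where
  "rmax = {x. x \<noteq> \<infinity>}"

definition rmax_vec :: "(ereal ^ 'n) set" where
  "rmax_vec = {x. \<forall>i. x $ i \<in> rmax}"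

definition rmax_mat :: "(ereal ^ 'n ^ 'n) set" where
  "rmax_mat = {A. \<forall>i j. A $ i $ j \<in> rmax}"

definition eps_vec :: "ereal ^ 'n" where
  "eps_vec = (\<chi> i. -\<infinity>)"

definition mp_unit :: "ereal ^ 'n ^ 'n" where
  "mp_unit = (\<chi> i j. if i = j then 0 else -\<infinity>)"

definition mp_add :: "ereal ^ 'n ^ 'n \<Rightarrow> ereal ^ 'n ^ 'n \<Rightarrow> ereal ^ 'n ^ 'n" where
  "mp_add A B = (\<chi> i j. max (A $ i $ j) (B $ i $ j))"

definition mp_scale :: "ereal \<Rightarrow> ereal ^ 'n ^ 'n \<Rightarrow> ereal ^ 'n ^ 'n" where
  "mp_scale t A = (\<chi> i j. t + A $ i $ j)"

definition mp_mult_vec :: "ereal ^ 'n ^ 'n \<Rightarrow> ereal ^ 'n \<Rightarrow> ereal ^ 'n" where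
  "mp_mult_vec A x = (\<chi> i. SUP j. A $ i $ j + x $ j)"

text \<open>
  The max-plus power is the ordinary multiple.  Note \<^prop>\<open>(0::ereal) * (-\<infinity>) = 0\<close>, so the
  zeroth power of epsilon is e.
\<close>

definition mp_power :: "ereal \<Rightarrow> nat \<Rightarrow> ereal" where
  "mp_power x k = ereal (real k) * x"

definition mp_det :: "ereal ^ 'n ^ 'n \<Rightarrow> ereal" where
  "mp_det A = (SUP p \<in> {p. p permutes (UNIV :: 'n set)}. \<Sum>i\<in>UNIV. A $ i $ p i)"

definition mp_char_poly :: "ereal ^ 'n ^ 'n \<Rightarrow> ereal \<Rightarrow> ereal" where
  "mp_char_poly A t = mp_det (mp_add A (mp_scale t mp_unit))"

text \<open>
  In \<open>mp_factorization A R m\<close>, the set \<^term>\<open>R\<close> consists of the distinct roots of the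
  characteristic polynomial and \<^term>\<open>m\<close> gives their multiplicities.
\<close>

definition mp_factorization :: "ereal ^ 'n ^ 'n \<Rightarrow> ereal set \<Rightarrow> (ereal \<Rightarrow> nat) \<Rightarrow> bool" where
  "mp_factorization A R m \<longleftrightarrow>
     finite R \<and> R \<subseteq> rmax \<and> (\<forall>r\<in>R. m r \<ge> 1) \<and> (\<Sum>r\<in>R. m r) = CARD('n) \<and>
     (\<forall>t\<in>rmax. mp_char_poly A t = (\<Sum>r\<in>R. mp_power (max t r) (m r)))"

definition alg_eigenvalue :: "ereal ^ 'n ^ 'n \<Rightarrow> ereal \<Rightarrow> bool" where
  "alg_eigenvalue A r \<longleftrightarrow> (\<exists>R m. mp_factorization A R m \<and> r \<in> R)"


section \<open>Multi-circuits\<close>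

definition mp_graph :: "ereal ^ 'n ^ 'n \<Rightarrow> ('n, 'n \<times> 'n) pre_digraph" where
  "mp_graph A = \<lparr>verts = UNIV, arcs = {(i, j). A $ i $ j \<noteq> -\<infinity>}, tail = fst, head = snd\<rparr>"

text \<open>
  A multi-circuit is represented by its edge set, which determines the circuits it is composed
  of.  Its vertex set is then its \<^const>\<open>Field\<close> and its length is its \<^const>\<open>card\<close>.
\<close>

definition multi_circuit :: "ereal ^ 'n ^ 'n \<Rightarrow> ('n \<times> 'n) set \<Rightarrow> bool" where
  "multi_circuit A C \<longleftrightarrow>
     (\<exists>P. (\<forall>p\<in>P. pre_digraph.cycle (mp_graph A) p) \<and>
          pairwise (\<lambda>p q. disjnt (Field (set p)) (Field (set q))) P \<and>
          C = (\<Union>p\<in>P. set p))"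

definition mc_weight :: "ereal ^ 'n ^ 'n \<Rightarrow> ('n \<times> 'n) set \<Rightarrow> ereal" where
  "mc_weight A C = (\<Sum>(i, j)\<in>C. A $ i $ j)"

definition real_maximal :: "ereal ^ 'n ^ 'n \<Rightarrow> real \<Rightarrow> ('n \<times> 'n) set \<Rightarrow> bool" where
  "real_maximal A l C \<longleftrightarrow>
     mp_char_poly A (ereal l) = mc_weight A C + mp_power (ereal l) (CARD('n) - card C)"

definition maximal_mc :: "ereal ^ 'n ^ 'n \<Rightarrow> ereal \<Rightarrow> ('n \<times> 'n) set \<Rightarrow> bool" where
  "maximal_mc A l C \<longleftrightarrow> multi_circuit A C \<and>
     (if l = -\<infinity> then \<forall>\<^sub>F \<mu> in at_bot. real_maximal A \<mu> C
      else real_maximal A (real_of_ereal l) C)"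

definition mat_on :: "ereal ^ 'n ^ 'n \<Rightarrow> ('n \<times> 'n) set \<Rightarrow> ereal ^ 'n ^ 'n" where
  "mat_on A C = (\<chi> i j. if (i, j) \<in> C then A $ i $ j else -\<infinity>)"

definition mat_off :: "ereal ^ 'n ^ 'n \<Rightarrow> ('n \<times> 'n) set \<Rightarrow> ereal ^ 'n ^ 'n" where
  "mat_off A C = (\<chi> i j. if (i, j) \<in> C then -\<infinity> else A $ i $ j)"

definition unit_on :: "('n \<times> 'n) set \<Rightarrow> ereal ^ 'n ^ 'n" where
  "unit_on C = (\<chi> i j. if i = j \<and> i \<in> Field C then 0 else -\<infinity>)"

definition unit_off :: "('n \<times> 'n) set \<Rightarrow> ereal ^ 'n ^ 'n" where
  "unit_off C = (\<chi> i j. if i = j \<and> i \<notin> Field C then 0 else -\<infinity>)"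

definition mc_space :: "ereal ^ 'n ^ 'n \<Rightarrow> ereal \<Rightarrow> ('n \<times> 'n) set \<Rightarrow> (ereal ^ 'n) set" where
  "mc_space A l C = {x \<in> rmax_vec.
     mp_mult_vec (mp_add (mat_off A C) (mp_scale l (unit_on C))) x =
     mp_mult_vec (mp_add (mat_on A C) (mp_scale l (unit_off C))) x}"


section \<open>Algebraic eigenspaces\<close>

text \<open>The property written as a star in the literature.\<close>

definition star_property :: "ereal ^ 'n ^ 'n \<Rightarrow> bool" where
  "star_property A \<longleftrightarrow>
     (\<forall>l\<in>rmax. \<forall>C D. maximal_mc A l C \<and> maximal_mc A l D \<and> C \<noteq> D \<longrightarrow> card C \<noteq> card D)"

definition perturb :: "ereal ^ 'n ^ 'n \<Rightarrow> real ^ 'n ^ 'n \<Rightarrow> real \<Rightarrow> ereal ^ 'n ^ 'n" where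
  "perturb A \<zeta> \<delta> = (\<chi> i j. A $ i $ j - ereal (\<zeta> $ i $ j * \<delta>))"

definition generic_dirs :: "ereal ^ 'n ^ 'n \<Rightarrow> (real ^ 'n ^ 'n) set" where
  "generic_dirs A = {\<zeta>. (\<forall>i j. \<zeta> $ i $ j \<in> {0..1}) \<and>
     (\<exists>\<delta>'>0. \<forall>\<delta>. 0 < \<delta> \<and> \<delta> < \<delta>' \<longrightarrow> star_property (perturb A \<zeta> \<delta>))}"

definition mp_ball :: "ereal \<Rightarrow> real \<Rightarrow> ereal set" where
  "mp_ball l r = (if l = -\<infinity> then {-\<infinity>} else {l - ereal r .. l + ereal r})"

text \<open>
  In \<open>mp_sum K U\<close> the index set may be infinite; when all but finitely many of the
  subspaces are trivial, as in the definition of the algebraic eigenspace, the supremum below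
  is effectively a maximum over finitely many vectors.
\<close>

definition mp_sum :: "'k set \<Rightarrow> ('k \<Rightarrow> (ereal ^ 'n) set) \<Rightarrow> (ereal ^ 'n) set" where
  "mp_sum K U = {(\<chi> i. SUP k\<in>K. x k $ i) | x. \<forall>k\<in>K. x k \<in> U k}"

definition mp_limit :: "(real \<Rightarrow> (ereal ^ 'n) set) \<Rightarrow> (ereal ^ 'n) set" where
  "mp_limit S = {x \<in> rmax_vec. \<exists>y. (\<forall>\<^sub>F \<delta> in at_right 0. y \<delta> \<in> S \<delta>) \<and>
     (y \<longlongrightarrow> x) (at_right 0)}"

text \<open>
  The maximal multi-circuits used to define the algebraic eigenspace are arbitrary.  They are
  given by a selection function \<^term>\<open>C\<close>, where \<^term>\<open>C \<zeta> \<delta> l\<close> is an l-maximal multi-circuit of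
  the perturbed matrix; the eigenspace takes the selection as a parameter but does not depend
  on it.
\<close>

type_synonym 'n mc_selection = "real ^ 'n ^ 'n \<Rightarrow> real \<Rightarrow> ereal \<Rightarrow> ('n \<times> 'n) set"

definition maximal_selection :: "ereal ^ 'n ^ 'n \<Rightarrow> 'n mc_selection \<Rightarrow> bool" where
  "maximal_selection A C \<longleftrightarrow>
     (\<forall>\<zeta>\<in>generic_dirs A. \<forall>\<delta>>0. \<forall>l\<in>rmax. maximal_mc (perturb A \<zeta> \<delta>) l (C \<zeta> \<delta> l))"

definition alg_eigenspace ::
    "'n mc_selection \<Rightarrow> ereal ^ 'n ^ 'n \<Rightarrow> ereal \<Rightarrow> (ereal ^ 'n) set" where
  "alg_eigenspace C A l = (\<Inter>\<zeta>\<in>generic_dirs A. mp_limit (\<lambda>\<delta>.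
     mp_sum (mp_ball l (real CARD('n) * \<delta>))
       (\<lambda>l'. mc_space (perturb A \<zeta> \<delta>) l' (C \<zeta> \<delta> l'))))"

end

theory Submission
  imports Defs "HOL-Combinatorics.Cycles"
begin

text \<open>
  Let \<open>\<lambda>\<^sub>1 < \<lambda>\<^sub>2\<close> and suppose that \<open>x\<close>, different from the epsilon vector and with support \<open>S\<close>, lies in
  both eigenspaces.  Row \<open>i\<close> of the equation defining \<open>W(A, \<lambda>, \<C>)\<close> says that the largest of the terms
  \<open>a\<^sub>i\<^sub>j + x\<^sub>j\<close> and \<open>\<lambda> + x\<^sub>i\<close> is attained along \<open>\<C>\<close> (along a loop of weight \<open>\<lambda>\<close> if \<open>i\<close> is no vertex of
  \<open>\<C>\<close>), and a second time elsewhere.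

  In particular \<open>A \<otimes> x \<ge> \<lambda> \<otimes> x\<close>, which is stable under sums and limits.  Membership in the
  eigenspace of \<open>\<lambda>\<^sub>2\<close> thus gives \<open>(A \<otimes> x)\<^sub>i \<ge> \<lambda>\<^sub>2 + x\<^sub>i > \<lambda>\<^sub>1 + x\<^sub>i\<close> for all \<open>i\<close> in \<open>S\<close>.  So at the level of \<open>\<lambda>\<^sub>1\<close>
  the rows in \<open>S\<close> take their maximum off the diagonal loop, at columns in \<open>S\<close>.

  The rest happens at one small \<open>\<delta>\<close> in a generic direction, for a vector \<open>u\<close> close to \<open>x\<close> that is a
  sum of vectors \<open>x\<^sub>k\<close> from spaces \<open>W(A\<^sub>\<delta>, k, \<C>\<^sub>k)\<close> with parameters \<open>k\<close> near \<open>\<lambda>\<^sub>1\<close>.  A priori, different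
  rows of \<open>u\<close> may be governed by different summands with different multi-circuits.  But the \<open>\<C>\<^sub>k\<close>
  are maximal at parameters at distance \<open>O(\<delta>)\<close>, so by complementary slackness for the assignment
  problem (lemma \<open>mc_space_near_optimal\<close>) each of them attains the row maxima of every summand
  up to \<open>O(\<delta>)\<close>.  Since the gaps above do not shrink with \<open>\<delta>\<close>, every \<open>\<C>\<^sub>k\<close> must permute \<open>S\<close>, and the
  star property makes all of them equal on \<open>S\<close> (lemma \<open>star_local_unique\<close>).  Now every row of \<open>S\<close> has
  its maximum on this common permutation and on a second column in \<open>S\<close>, exactly and not merely up
  to \<open>O(\<delta>)\<close>.  Alternating between the two choices closes up to a second permutation of \<open>S\<close> (lemma
  \<open>second_permutation\<close>) of the same length and weight, which contradicts the star property; this is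
  lemma \<open>mp_sum_row_gap_contradiction\<close>.

  Genericity is essential: with several permutations of \<open>S\<close> of maximal weight, the spaces at all
  parameters below \<open>\<lambda>\<^sub>2\<close> could share a vector.  That generic directions exist is lemma
  \<open>generic_dirs_nonempty\<close>.
\<close>

section \<open>Multi-circuits as permutations\<close>

text \<open>
  A multi-circuit is the graph of a permutation of its vertex set, fixed points being loops.
  In this form circuits can be cut and pasted: whenever two permutations have the same image on
  a set of rows, one may be exchanged for the other there.
\<close>

definition perm_edges :: "('n \<Rightarrow> 'n) \<Rightarrow> 'n set \<Rightarrow> ('n \<times> 'n) set" where
  "perm_edges p V = (\<lambda>i. (i, p i)) ` V"

lemma Field_perm_edges: "p permutes V \<Longrightarrow> Field (perm_edges p V) = V"
  by (auto simp: Field_def perm_edges_def permutes_in_image Domain_unfold Range.simps image_iff)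

lemma card_perm_edges: "card (perm_edges p V) = card V"
  unfolding perm_edges_def by (rule card_image) (auto simp: inj_on_def)

lemma mem_perm_edges [simp]: "(i, j) \<in> perm_edges p V \<longleftrightarrow> i \<in> V \<and> j = p i"
  by (auto simp: perm_edges_def)

lemma perm_edges_eq_imp:
  assumes "perm_edges p V = perm_edges q U" "i \<in> V"
  shows "p i = q i"
  using assms mem_perm_edges by metis

lemma mc_weight_perm_edges: "mc_weight A (perm_edges p V) = (\<Sum>i\<in>V. A $ i $ p i)"
  unfolding mc_weight_def perm_edges_def
  by (subst sum.reindex) (auto simp: inj_on_def)

text \<open>
  Read as a list of tails and a list of heads, a closed walk is the same list rotated by one
  position.  Hence the two lists agree as multisets, and distinctness of the heads gives in- and
  out-degree one at every vertex of a cycle.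
\<close>

lemma cas_closed_verts:
  assumes "pre_digraph.cas (mp_graph A) u es v"
  shows "map fst es @ [v] = u # map snd es"
  using assms
proof (induction es arbitrary: u)
  case Nil
  then show ?case by (simp add: pre_digraph.cas.simps)
next
  case (Cons e es)
  then show ?case by (auto simp: pre_digraph.cas.simps mp_graph_def)
qed

lemma cycle_degrees:
  assumes "pre_digraph.cycle (mp_graph A) es"
  shows "inj_on fst (set es)" "inj_on snd (set es)" "fst ` set es = snd ` set es"
    "\<And>i j. (i, j) \<in> set es \<Longrightarrow> A $ i $ j \<noteq> -\<infinity>"
proof -
  from assms obtain u where u: "pre_digraph.awalk (mp_graph A) u es u"
    and d: "distinct (tl (pre_digraph.awalk_verts (mp_graph A) u es))" and ne: "es \<noteq> []"
    unfolding pre_digraph.cycle_def by blast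
  have c: "pre_digraph.cas (mp_graph A) u es u"
    using u by (simp add: pre_digraph.awalk_def)
  note e = cas_closed_verts[OF c]
  have "tl (pre_digraph.awalk_verts (mp_graph A) u es) = map snd es"
    using pre_digraph.awalk_verts_conv'[OF c] ne by (simp add: mp_graph_def)
  with d have d2: "distinct (map snd es)" by simp
  have m: "mset (map fst es) = mset (map snd es)"
    using arg_cong[OF e, of mset] by simp
  have d1: "distinct (map fst es)"
    using m d2 by (metis mset_eq_imp_distinct_iff)
  show "inj_on fst (set es)" "inj_on snd (set es)"
    using d1 d2 by (simp_all add: distinct_map)
  show "fst ` set es = snd ` set es"
    using mset_eq_setD[OF m] by simp
  show "A $ i $ j \<noteq> -\<infinity>" if "(i, j) \<in> set es" for i j
    using u that by (auto simp: pre_digraph.awalk_def mp_graph_def)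
qed

lemma multi_circuit_imp_perm:
  fixes A :: "ereal ^ 'n::finite ^ 'n"
  assumes "multi_circuit A C"
  obtains p V where "p permutes V" "C = perm_edges p V" "\<And>i. i \<in> V \<Longrightarrow> A $ i $ p i \<noteq> -\<infinity>"
proof -
  from assms obtain P where cyc: "\<And>p. p \<in> P \<Longrightarrow> pre_digraph.cycle (mp_graph A) p"
    and dj: "pairwise (\<lambda>p q. disjnt (Field (set p)) (Field (set q))) P"
    and C: "C = (\<Union>p\<in>P. set p)" unfolding multi_circuit_def by blast
  have same: "p = q" if "p \<in> P" "q \<in> P" "v \<in> Field (set p)" "v \<in> Field (set q)" for p q v
    using dj that unfolding pairwise_def disjnt_iff by blast
  have ifst: "j = j'" if h: "(i, j) \<in> C" "(i, j') \<in> C" for i j j'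
  proof -
    obtain p q where pq: "p \<in> P" "q \<in> P" "(i, j) \<in> set p" "(i, j') \<in> set q"
      using h unfolding C by blast
    then have "p = q" by (meson same FieldI1)
    then show ?thesis using inj_onD[OF cycle_degrees(1)[OF cyc[OF pq(1)]], of "(i, j)" "(i, j')"] pq by simp
  qed
  have isnd: "i = i'" if h: "(i, j) \<in> C" "(i', j) \<in> C" for i i' j
  proof -
    obtain p q where pq: "p \<in> P" "q \<in> P" "(i, j) \<in> set p" "(i', j) \<in> set q"
      using h unfolding C by blast
    then have "p = q" by (meson same FieldI2)
    then show ?thesis using inj_onD[OF cycle_degrees(2)[OF cyc[OF pq(1)]], of "(i, j)" "(i', j)"] pq by simp
  qed
  have im: "fst ` C = snd ` C"
    unfolding C image_UN using cycle_degrees(3)[OF cyc] by auto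
  define V where "V = fst ` C"
  define f where "f i = (if i \<in> V then THE j. (i, j) \<in> C else i)" for i
  have f: "(i, f i) \<in> C" if "i \<in> V" for i
  proof -
    have "\<exists>j. (i, j) \<in> C" using that by (auto simp: V_def)
    then have "\<exists>!j. (i, j) \<in> C" using ifst by blast
    from theI'[OF this] show ?thesis using that by (simp add: f_def)
  qed
  have Ceq: "C = perm_edges f V"
  proof (intro set_eqI iffI)
    fix e assume e: "e \<in> C"
    then have "fst e \<in> V" by (simp add: V_def)
    with f[OF this] e ifst[of "fst e" "snd e" "f (fst e)"]
    show "e \<in> perm_edges f V" by (cases e) auto
  qed (auto simp: perm_edges_def f)
  have "f permutes V"
  proof (rule bij_imp_permutes)
    have "inj_on f V" using f isnd by (metis inj_onI)
    moreover have "f ` V = V"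
      using im unfolding V_def[symmetric] Ceq perm_edges_def image_image by simp
    ultimately show "bij_betw f V V" by (simp add: bij_betw_def)
  qed (simp add: f_def)
  moreover have "A $ i $ f i \<noteq> -\<infinity>" if "i \<in> V" for i
    using f[OF that] cycle_degrees(4)[OF cyc] C by blast
  ultimately show thesis using that Ceq by blast
qed

text \<open>
  The cycles of a permutation, written as arc walks, are the trajectories
  \<open>x, p x, p (p x), \<dots>\<close>; the starting exponent is general so that induction on the length works.
\<close>

lemma cas_orbit:
  "pre_digraph.cas (mp_graph A) ((p ^^ a) x)
     (map (\<lambda>i. ((p ^^ i) x, p ((p ^^ i) x))) [a..<a + m]) ((p ^^ (a + m)) x)"
proof (induction m arbitrary: a)
  case 0
  then show ?case by (simp add: pre_digraph.cas.simps)
next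
  case (Suc m)
  have "[a..<a + Suc m] = a # [Suc a..<Suc a + m]" by (simp add: upt_rec)
  then show ?case using Suc[of "Suc a"]
    by (simp add: pre_digraph.cas.simps mp_graph_def)
qed

text \<open>
  The orbits of \<^term>\<open>p\<close> inside \<^term>\<open>V\<close> are the circuits.  One starting vertex is chosen in each
  orbit, because different starting vertices give different arc lists for the same circuit and
  those would not be vertex-disjoint.
\<close>

lemma perm_imp_multi_circuit:
  fixes A :: "ereal ^ 'n::finite ^ 'n"
  assumes p: "p permutes V" and fin: "\<And>i. i \<in> V \<Longrightarrow> A $ i $ p i \<noteq> -\<infinity>"
  shows "multi_circuit A (perm_edges p V)"
proof -
  have perm: "permutation p" using p by (auto simp: permutation_permutes)
  define cyc where "cyc x = map (\<lambda>v. (v, p v)) (support p x)" for x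
  have supp_V: "set (support p x) \<subseteq> V" if "x \<in> V" for x
    using that permutes_in_image[OF permutes_funpow[OF p]] by auto
  have setc: "set (cyc x) = perm_edges p (set (support p x))" for x
    by (auto simp: cyc_def perm_edges_def image_image)
  have mem: "x \<in> set (support p x)" for x
    unfolding support_set[OF perm] by (rule range_eqI[of _ _ 0]) simp
  have fld: "Field (set (cyc x)) = set (support p x)" for x
  proof -
    have "p ((p ^^ i) x) \<in> set (support p x)" for i
      unfolding support_set[OF perm] by (rule range_eqI[of _ _ "Suc i"]) simp
    then have "p ` set (support p x) \<subseteq> set (support p x)"
      by (auto simp del: set_map simp add: support_set[OF perm])
    then show ?thesis by (auto simp: setc Field_def)
  qed
  have cycle: "pre_digraph.cycle (mp_graph A) (cyc x)" if x: "x \<in> V" for x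
  proof -
    have ne: "cyc x \<noteq> []" using mem[of x] by (auto simp: cyc_def)
    have "pre_digraph.cas (mp_graph A) x (cyc x) ((p ^^ least_power p x) x)"
      using cas_orbit[where A=A and p=p and a=0 and x=x and m="least_power p x"] by (simp add: cyc_def o_def)
    then have c: "pre_digraph.cas (mp_graph A) x (cyc x) x"
      using least_power_of_permutation(1)[OF perm, of x] by simp
    then have w: "pre_digraph.awalk (mp_graph A) x (cyc x) x"
      using supp_V[OF x] fin by (auto simp: pre_digraph.awalk_def mp_graph_def cyc_def)
    have "tl (pre_digraph.awalk_verts (mp_graph A) x (cyc x)) = map p (support p x)"
      using pre_digraph.awalk_verts_conv'[OF c] ne by (simp add: mp_graph_def cyc_def o_def)
    moreover have "distinct (map p (support p x))"
      using cycle_of_permutation[OF perm, of x] inj_on_subset[OF permutes_inj[OF p] subset_UNIV]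
      by (simp only: distinct_map[of p])
    ultimately show ?thesis unfolding pre_digraph.cycle_def using w ne by metis
  qed
  define orb where "orb x = set (support p x)" for x
  define rep where "rep S = (SOME x. x \<in> V \<and> orb x = S)" for S
  define P where "P = (\<lambda>S. cyc (rep S)) ` orb ` V"
  have rep: "rep S \<in> V \<and> orb (rep S) = S" if "S \<in> orb ` V" for S
    unfolding rep_def by (rule someI_ex) (use that in blast)
  have fld_rep: "Field (set (cyc (rep S))) = S" if "S \<in> orb ` V" for S
    using rep[OF that] fld[of "rep S"] by (simp add: orb_def)
  have "pairwise (\<lambda>c d. disjnt (Field (set c)) (Field (set d))) P"
  proof (rule pairwiseI)
    fix c d assume "c \<in> P" "d \<in> P" and ne: "c \<noteq> d"
    then obtain S T where S: "S \<in> orb ` V" "c = cyc (rep S)" and T: "T \<in> orb ` V" "d = cyc (rep T)"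
      unfolding P_def by blast
    then have "S \<noteq> T" using ne by blast
    moreover have "disjoint (range orb)"
      using disjoint_support[OF perm] by (simp add: orb_def[abs_def])
    ultimately have "S \<inter> T = {}"
      using S(1) T(1) unfolding disjoint_def by blast
    then show "disjnt (Field (set c)) (Field (set d))"
      using S T fld_rep by (simp add: disjnt_def)
  qed
  moreover have "perm_edges p V = (\<Union>c\<in>P. set c)"
  proof -
    have "set (cyc (rep S)) = perm_edges p S" if "S \<in> orb ` V" for S
      using rep[OF that] setc[of "rep S"] by (simp add: orb_def)
    then have "(\<Union>c\<in>P. set c) = (\<Union>x\<in>V. perm_edges p (orb x))"
      by (simp add: P_def)
    also have "\<dots> = perm_edges p V"
      using mem supp_V unfolding perm_edges_def orb_def[symmetric] by blast
    finally show ?thesis by simp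
  qed
  moreover have "\<forall>c\<in>P. pre_digraph.cycle (mp_graph A) c"
    using rep cycle unfolding P_def by blast
  ultimately show ?thesis unfolding multi_circuit_def by blast
qed

section \<open>Maximal multi-circuits\<close>

definition perm_circuit :: "ereal ^ 'n ^ 'n \<Rightarrow> ('n \<Rightarrow> 'n) \<Rightarrow> 'n set \<Rightarrow> bool" where
  "perm_circuit A p V \<longleftrightarrow> p permutes V \<and> (\<forall>i\<in>V. A $ i $ p i \<noteq> -\<infinity>)"

lemma multi_circuit_iff:
  fixes A :: "ereal ^ 'n::finite ^ 'n"
  shows "multi_circuit A C \<longleftrightarrow> (\<exists>p V. perm_circuit A p V \<and> C = perm_edges p V)"
  unfolding perm_circuit_def by (metis multi_circuit_imp_perm perm_imp_multi_circuit)

text \<open>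
  The term that \<^term>\<open>p\<close>, continued by loops of weight \<^term>\<open>l\<close> outside \<^term>\<open>V\<close>, contributes to the
  characteristic polynomial at \<^term>\<open>l\<close>.  Summing over all rows, and over real numbers, permits
  exchange arguments that compare two such sums row by row.
\<close>

definition circuit_value :: "ereal ^ 'n ^ 'n \<Rightarrow> real \<Rightarrow> ('n \<Rightarrow> 'n) \<Rightarrow> 'n set \<Rightarrow> real" where
  "circuit_value A l p V = (\<Sum>i\<in>UNIV. if i \<in> V then real_of_ereal (A $ i $ p i) else l)"

lemma rmax_mat_entry: "A \<in> rmax_mat \<Longrightarrow> A $ i $ j \<noteq> \<infinity>"
  by (simp add: rmax_mat_def rmax_def)

lemma perm_circuit_entry:
  assumes "A \<in> rmax_mat" "perm_circuit A p V" "i \<in> V"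
  shows "A $ i $ p i = ereal (real_of_ereal (A $ i $ p i))"
  using assms rmax_mat_entry[of A i "p i"] by (cases "A $ i $ p i") (auto simp: perm_circuit_def)

lemma circuit_value_eq:
  fixes A :: "ereal ^ 'n::finite ^ 'n"
  shows "circuit_value A l p V =
    (\<Sum>i\<in>V. real_of_ereal (A $ i $ p i)) + real (CARD('n) - card V) * l"
proof -
  have "circuit_value A l p V = (\<Sum>i\<in>V. real_of_ereal (A $ i $ p i)) + (\<Sum>i\<in>-V. l)"
    unfolding circuit_value_def by (subst sum.If_cases) (auto simp: Compl_eq)
  then show ?thesis by (simp add: Compl_eq_Diff_UNIV card_Diff_subset)
qed

lemma real_maximal_iff:
  fixes A :: "ereal ^ 'n::finite ^ 'n"
  assumes "A \<in> rmax_mat" "perm_circuit A p V"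
  shows "real_maximal A l (perm_edges p V) \<longleftrightarrow>
    mp_char_poly A (ereal l) = ereal (circuit_value A l p V)"
proof -
  have "mc_weight A (perm_edges p V) = ereal (\<Sum>i\<in>V. real_of_ereal (A $ i $ p i))"
    unfolding mc_weight_perm_edges sum_ereal[symmetric]
    by (rule sum.cong) (use perm_circuit_entry[OF assms] in auto)
  then show ?thesis
    by (simp add: real_maximal_def circuit_value_eq card_perm_edges mp_power_def)
qed

lemma circuit_value_le_char_poly:
  fixes A :: "ereal ^ 'n::finite ^ 'n"
  assumes "A \<in> rmax_mat" "perm_circuit A p V"
  shows "ereal (circuit_value A l p V) \<le> mp_char_poly A (ereal l)"
proof -
  have p: "p permutes V" using assms by (simp add: perm_circuit_def)
  have "ereal (circuit_value A l p V) =
    (\<Sum>i\<in>UNIV. ereal (if i \<in> V then real_of_ereal (A $ i $ p i) else l))"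
    by (simp add: circuit_value_def)
  also have "\<dots> \<le> (\<Sum>i\<in>UNIV. mp_add A (mp_scale (ereal l) mp_unit) $ i $ p i)"
  proof (rule sum_mono)
    fix i
    show "ereal (if i \<in> V then real_of_ereal (A $ i $ p i) else l)
        \<le> mp_add A (mp_scale (ereal l) mp_unit) $ i $ p i"
      using perm_circuit_entry[OF assms, of i] permutes_not_in[OF p, of i]
      by (auto simp: mp_add_def mp_scale_def mp_unit_def)
  qed
  also have "\<dots> \<le> mp_char_poly A (ereal l)"
    unfolding mp_char_poly_def mp_det_def
    by (rule SUP_upper) (use permutes_subset[OF p] in auto)
  finally show ?thesis .
qed

lemma real_maximal_optimal:
  fixes A :: "ereal ^ 'n::finite ^ 'n"
  assumes "A \<in> rmax_mat" "perm_circuit A p V" "perm_circuit A q U"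
    and "real_maximal A l (perm_edges p V)"
  shows "circuit_value A l q U \<le> circuit_value A l p V"
  using circuit_value_le_char_poly[OF assms(1,3), of l] real_maximal_iff[OF assms(1,2), of l] assms(4)
  by simp

text \<open>
  Both cases in the definition of maximality ask for maximality at the real parameters eventually
  along a proper filter: the principal filter at a real parameter, and
  \<^term>\<open>at_bot :: real filter\<close> at epsilon.  This makes case distinctions on the parameter superfluous in the next lemma.
\<close>

lemma maximal_mc_eventually:
  "\<exists>F. F \<noteq> bot \<and> (\<forall>D. maximal_mc A l D \<longleftrightarrow>
    multi_circuit A D \<and> (\<forall>\<^sub>F m in F. real_maximal A m D))"
proof (cases "l = -\<infinity>")
  case True
  then show ?thesis by (intro exI[of _ at_bot]) (simp add: maximal_mc_def)
next
  case False
  then show ?thesis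
    by (intro exI[of _ "principal {real_of_ereal l}"])
      (simp add: maximal_mc_def eventually_principal principal_eq_bot_iff)
qed

text \<open>
  Multi-circuits of equal length complete to a spanning permutation with equally many loops, so
  their values at any parameter differ exactly by their weights.
\<close>

lemma maximal_same_length:
  fixes A :: "ereal ^ 'n::finite ^ 'n"
  assumes A: "A \<in> rmax_mat" and p: "perm_circuit A p V" and q: "perm_circuit A q U"
    and max: "maximal_mc A l (perm_edges p V)" and card: "card U = card V"
  shows "(\<Sum>i\<in>U. real_of_ereal (A $ i $ q i)) \<le> (\<Sum>i\<in>V. real_of_ereal (A $ i $ p i))"
    and "(\<Sum>i\<in>V. real_of_ereal (A $ i $ p i)) \<le> (\<Sum>i\<in>U. real_of_ereal (A $ i $ q i))
      \<Longrightarrow> maximal_mc A l (perm_edges q U)"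
proof -
  obtain F where F: "F \<noteq> bot" and iff: "\<And>D. maximal_mc A l D \<longleftrightarrow>
      multi_circuit A D \<and> (\<forall>\<^sub>F m in F. real_maximal A m D)"
    using maximal_mc_eventually[of A l] by blast
  have ev: "\<forall>\<^sub>F m in F. real_maximal A m (perm_edges p V)" using max iff by blast
  obtain m where "real_maximal A m (perm_edges p V)"
    using eventually_happens[OF ev] F by blast
  from real_maximal_optimal[OF A p q this]
  show le: "(\<Sum>i\<in>U. real_of_ereal (A $ i $ q i)) \<le> (\<Sum>i\<in>V. real_of_ereal (A $ i $ p i))"
    using card by (simp add: circuit_value_eq)
  assume ge: "(\<Sum>i\<in>V. real_of_ereal (A $ i $ p i)) \<le> (\<Sum>i\<in>U. real_of_ereal (A $ i $ q i))"
  have "circuit_value A m p V = circuit_value A m q U" for m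
    using le ge card by (simp add: circuit_value_eq)
  then have "\<forall>\<^sub>F m in F. real_maximal A m (perm_edges q U)"
    using ev real_maximal_iff[OF A p] real_maximal_iff[OF A q] by simp
  then show "maximal_mc A l (perm_edges q U)"
    using iff q multi_circuit_iff by blast
qed

text \<open>
  The form in which the star property is used.  If a maximal multi-circuit maps \<^term>\<open>S\<close> to itself,
  then replacing its part on \<^term>\<open>S\<close> by another permutation of \<^term>\<open>S\<close> yields a multi-circuit of the same
  length; if no weight is lost, the result is maximal too and must be the original one.
\<close>

lemma star_local_unique:
  fixes A :: "ereal ^ 'n::finite ^ 'n"
  assumes A: "A \<in> rmax_mat" and star: "star_property A" and l: "l \<in> rmax"
    and p: "perm_circuit A p V" and max: "maximal_mc A l (perm_edges p V)"
    and S: "S \<subseteq> V" "p ` S = S" "q ` S = S"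
    and fin: "\<And>i. i \<in> S \<Longrightarrow> A $ i $ q i \<noteq> -\<infinity>"
    and ge: "(\<Sum>i\<in>S. real_of_ereal (A $ i $ p i)) \<le> (\<Sum>i\<in>S. real_of_ereal (A $ i $ q i))"
    and i: "i \<in> S"
  shows "q i = p i"
proof -
  define r where "r i = (if i \<in> S then q i else p i)" for i
  have pV: "p permutes V" using p by (simp add: perm_circuit_def)
  have "p ` (V - S) = V - S"
    using S permutes_image[OF pV] permutes_inj[OF pV] by (simp add: image_set_diff)
  then have "r ` (V - S) = V - S" "r ` S = S" using S by (auto simp: r_def)
  then have rV: "r ` V = V" using S by (metis Un_Diff_cancel image_Un sup.absorb_iff2)
  have "r permutes V"
  proof (rule bij_imp_permutes)
    show "bij_betw r V V" using rV by (simp add: bij_betw_def eq_card_imp_inj_on)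
    show "r x = x" if "x \<notin> V" for x
      using that S permutes_not_in[OF pV] by (auto simp: r_def)
  qed
  then have r: "perm_circuit A r V"
    using p fin by (auto simp: perm_circuit_def r_def)
  have split: "(\<Sum>i\<in>V. f i) = (\<Sum>i\<in>S. f i) + (\<Sum>i\<in>V - S. f i)" for f :: "'n \<Rightarrow> real"
    using sum.subset_diff[OF S(1), of f] by simp
  have "(\<Sum>i\<in>V. real_of_ereal (A $ i $ p i)) \<le> (\<Sum>i\<in>V. real_of_ereal (A $ i $ r i))"
    unfolding split using ge by (simp add: r_def)
  then have "maximal_mc A l (perm_edges r V)"
    by (rule maximal_same_length(2)[OF A p r max refl])
  then have "perm_edges r V = perm_edges p V"
    using star l max unfolding star_property_def by (metis card_perm_edges)
  then show ?thesis using perm_edges_eq_imp[of r V p V i] i S by (auto simp: r_def)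
qed

section \<open>Equations of the space attached to a multi-circuit\<close>

lemma ereal_max_add: "max a b + c = max (a + c) (b + c)" for a b c :: ereal
  by (cases "a \<le> b") (simp_all add: max.absorb1 max.absorb2 add_right_mono)

text \<open>
  Row by row, membership means that the largest of the terms \<open>a\<^sub>i\<^sub>j + x\<^sub>j\<close> and \<open>l + x\<^sub>i\<close> is attained on
  the multi-circuit (by the loop of weight \<^term>\<open>l\<close> outside its vertex set), and is attained
  a second time elsewhere.
\<close>

lemma mc_space_equations:
  fixes A :: "ereal ^ 'n::finite ^ 'n"
  assumes A: "A \<in> rmax_mat" and l: "l \<in> rmax" and p: "perm_circuit A p V"
    and x: "x \<in> mc_space A l (perm_edges p V)"
  shows "i \<in> V \<Longrightarrow> A $ i $ p i + x $ p i = max (l + x $ i) (SUP j\<in>-{p i}. A $ i $ j + x $ j)"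
    and "i \<notin> V \<Longrightarrow> l + x $ i = mp_mult_vec A x $ i"
proof -
  have fld: "Field (perm_edges p V) = V"
    using p by (simp add: perm_circuit_def Field_perm_edges)
  have xj: "x $ j \<noteq> \<infinity>" for j using x by (simp add: mc_space_def rmax_vec_def rmax_def)
  have l': "l \<noteq> \<infinity>" using l by (simp add: rmax_def)
  have bot: "-\<infinity> + x $ j = -\<infinity>" "l + -\<infinity> = -\<infinity>" for j using xj l' by auto
  have eq: "mp_mult_vec (mp_add (mat_off A (perm_edges p V)) (mp_scale l (unit_on (perm_edges p V)))) x $ i =
     mp_mult_vec (mp_add (mat_on A (perm_edges p V)) (mp_scale l (unit_off (perm_edges p V)))) x $ i"
    using x by (simp add: mc_space_def)
  show "A $ i $ p i + x $ p i = max (l + x $ i) (SUP j\<in>-{p i}. A $ i $ j + x $ j)" if i: "i \<in> V"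
  proof -
    have "mp_mult_vec (mp_add (mat_off A (perm_edges p V)) (mp_scale l (unit_on (perm_edges p V)))) x $ i
       = (SUP j. max (if j = p i then -\<infinity> else A $ i $ j + x $ j) (if i = j then l + x $ j else -\<infinity>))"
      unfolding mp_mult_vec_def vec_lambda_beta
      by (rule SUP_cong) (use i in \<open>auto simp: mp_add_def mp_scale_def mat_off_def unit_on_def fld
          ereal_max_add bot\<close>)
    also have "\<dots> = max (l + x $ i) (SUP j\<in>-{p i}. A $ i $ j + x $ j)"
    proof (rule antisym)
      show "(SUP j. max (if j = p i then -\<infinity> else A $ i $ j + x $ j) (if i = j then l + x $ j else -\<infinity>))
        \<le> max (l + x $ i) (SUP j\<in>-{p i}. A $ i $ j + x $ j)"
      proof (rule SUP_least)
        fix j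
        have "A $ i $ j + x $ j \<le> (SUP j\<in>-{p i}. A $ i $ j + x $ j)" if "j \<noteq> p i"
          using that by (intro SUP_upper) auto
        then show "max (if j = p i then -\<infinity> else A $ i $ j + x $ j) (if i = j then l + x $ j else -\<infinity>)
          \<le> max (l + x $ i) (SUP j\<in>-{p i}. A $ i $ j + x $ j)"
          by (auto intro: max.coboundedI1 max.coboundedI2)
      qed
      have "l + x $ i \<le> (SUP j. max (if j = p i then -\<infinity> else A $ i $ j + x $ j) (if i = j then l + x $ j else -\<infinity>))"
        by (rule SUP_upper2[of i]) auto
      moreover have "(SUP j\<in>-{p i}. A $ i $ j + x $ j)
         \<le> (SUP j. max (if j = p i then -\<infinity> else A $ i $ j + x $ j) (if i = j then l + x $ j else -\<infinity>))"
        by (rule SUP_subset_mono) auto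
      ultimately show "max (l + x $ i) (SUP j\<in>-{p i}. A $ i $ j + x $ j)
         \<le> (SUP j. max (if j = p i then -\<infinity> else A $ i $ j + x $ j) (if i = j then l + x $ j else -\<infinity>))"
        by simp
    qed
    finally have lhs: "mp_mult_vec (mp_add (mat_off A (perm_edges p V)) (mp_scale l (unit_on (perm_edges p V)))) x $ i
      = max (l + x $ i) (SUP j\<in>-{p i}. A $ i $ j + x $ j)" .
    have "mp_mult_vec (mp_add (mat_on A (perm_edges p V)) (mp_scale l (unit_off (perm_edges p V)))) x $ i
       = (SUP j. if j = p i then A $ i $ j + x $ j else -\<infinity>)"
      unfolding mp_mult_vec_def vec_lambda_beta
      by (rule SUP_cong) (use i in \<open>auto simp: mp_add_def mp_scale_def mat_on_def unit_off_def fld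
          ereal_max_add bot\<close>)
    also have "\<dots> = A $ i $ p i + x $ p i"
      by (rule antisym) (auto intro!: SUP_least SUP_upper2[of "p i"])
    finally show ?thesis using lhs eq by simp
  qed
  show "l + x $ i = mp_mult_vec A x $ i" if i: "i \<notin> V"
  proof -
    have "mp_mult_vec (mp_add (mat_off A (perm_edges p V)) (mp_scale l (unit_on (perm_edges p V)))) x $ i
       = mp_mult_vec A x $ i"
      using i by (auto simp: mp_mult_vec_def mp_add_def mp_scale_def mat_off_def unit_on_def fld bot)
    moreover have "mp_mult_vec (mp_add (mat_on A (perm_edges p V)) (mp_scale l (unit_off (perm_edges p V)))) x $ i
       = (SUP j. if i = j then l + x $ j else -\<infinity>)"
      unfolding mp_mult_vec_def vec_lambda_beta
      by (rule SUP_cong) (use i in \<open>auto simp: mp_add_def mp_scale_def mat_on_def unit_off_def fld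
          ereal_max_add bot\<close>)
    moreover have "\<dots> = l + x $ i"
      by (rule antisym) (auto intro!: SUP_least SUP_upper2[of i])
    ultimately show ?thesis using eq by simp
  qed
qed

lemma mc_space_row:
  fixes A :: "ereal ^ 'n::finite ^ 'n"
  assumes "A \<in> rmax_mat" "l \<in> rmax" "perm_circuit A p V" "x \<in> mc_space A l (perm_edges p V)"
  shows "mp_mult_vec A x $ i = (if i \<in> V then A $ i $ p i else l) + x $ p i"
    and "l + x $ i \<le> mp_mult_vec A x $ i"
proof -
  note eqs = mc_space_equations[OF assms, of i]
  have "mp_mult_vec A x $ i = A $ i $ p i + x $ p i \<and> l + x $ i \<le> A $ i $ p i + x $ p i" if i: "i \<in> V"
  proof (intro conjI antisym)
    show "mp_mult_vec A x $ i \<le> A $ i $ p i + x $ p i"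
      unfolding mp_mult_vec_def vec_lambda_beta
    proof (rule SUP_least)
      fix j
      show "A $ i $ j + x $ j \<le> A $ i $ p i + x $ p i"
      proof (cases "j = p i")
        case False
        then have "A $ i $ j + x $ j \<le> (SUP j\<in>-{p i}. A $ i $ j + x $ j)"
          by (intro SUP_upper) auto
        then show ?thesis unfolding eqs(1)[OF i] by (simp add: le_max_iff_disj)
      qed simp
    qed
    show "A $ i $ p i + x $ p i \<le> mp_mult_vec A x $ i"
      by (auto simp: mp_mult_vec_def intro: SUP_upper2[of "p i"])
    show "l + x $ i \<le> A $ i $ p i + x $ p i" unfolding eqs(1)[OF i] by simp
  qed
  moreover have "p i = i" if "i \<notin> V"
    using that assms(3) permutes_not_in by (fastforce simp: perm_circuit_def)
  ultimately show "mp_mult_vec A x $ i = (if i \<in> V then A $ i $ p i else l) + x $ p i"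
    and "l + x $ i \<le> mp_mult_vec A x $ i"
    using eqs(2) by (cases "i \<in> V"; simp)+
qed

text \<open>
  Complementary slackness.  If \<^term>\<open>p\<close> picks the largest term of every row and \<^term>\<open>q\<close> any term, the
  slack of each row is nonnegative.  Summed over the rows, the entries of \<^term>\<open>x\<close> cancel, since \<^term>\<open>p\<close>
  and \<^term>\<open>q\<close> are bijections, so the total slack is the difference of the weights of \<^term>\<open>p\<close> and
  \<^term>\<open>q\<close>.  If this is at most \<^term>\<open>\<eta>\<close>, so is every single slack.  Entries of \<^term>\<open>x\<close> equal to epsilon
  force the restriction to those rows that \<^term>\<open>p\<close> maps into the support of \<^term>\<open>x\<close>.
\<close>

lemma near_optimal_row_terms:
  fixes f g :: "'n::finite \<Rightarrow> real" and x :: "'n \<Rightarrow> ereal"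
  assumes p: "bij p" and q: "bij q" and x: "\<And>j. x j \<noteq> \<infinity>"
    and le: "\<And>i. ereal (g i) + x (q i) \<le> ereal (f i) + x (p i)"
    and near: "\<And>I. p ` I = q ` I \<Longrightarrow> (\<Sum>i\<in>I. f i) \<le> (\<Sum>i\<in>I. g i) + \<eta>"
  shows "ereal (f i) + x (p i) \<le> ereal (g i) + x (q i) + ereal \<eta>"
proof (cases "x (p i) = -\<infinity>")
  case False
  define T where "T = {j. x j \<noteq> -\<infinity>}"
  define I where "I = p -` T"
  have card: "card (r -` T) = card T" if "bij r" for r :: "'n \<Rightarrow> 'n"
    using that by (simp add: card_vimage_inj bij_is_inj bij_is_surj)
  have "q -` T \<subseteq> I"
  proof
    fix j assume "j \<in> q -` T"
    then show "j \<in> I" using le[of j] x[of "q j"] x[of "p j"]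
      by (cases "x (q j)"; cases "x (p j)") (auto simp: T_def I_def)
  qed
  then have I: "q -` T = I"
    by (intro card_seteq) (auto simp: card p q I_def)
  have img: "p ` I = T" "q ` I = T"
    using surj_image_vimage_eq[OF bij_is_surj[OF p], of T]
      surj_image_vimage_eq[OF bij_is_surj[OF q], of T] I by (simp_all add: I_def)
  define y where "y j = real_of_ereal (x j)" for j
  have y: "x j = ereal (y j)" if "j \<in> T" for j
    using that x[of j] by (cases "x j") (auto simp: T_def y_def)
  have mem: "p j \<in> T" "q j \<in> T" if "j \<in> I" for j using that img by blast+
  define s where "s j = (f j + y (p j)) - (g j + y (q j))" for j
  have s0: "0 \<le> s j" if "j \<in> I" for j
    using le[of j] mem[OF that] by (simp add: y s_def)
  have "(\<Sum>j\<in>I. y (p j)) = (\<Sum>j\<in>T. y j)" "(\<Sum>j\<in>I. y (q j)) = (\<Sum>j\<in>T. y j)"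
    using sum.reindex[of p I y] sum.reindex[of q I y] img
      inj_on_subset[OF bij_is_inj[OF p]] inj_on_subset[OF bij_is_inj[OF q]] by (auto simp: o_def)
  then have "(\<Sum>j\<in>I. s j) = (\<Sum>j\<in>I. f j) - (\<Sum>j\<in>I. g j)"
    by (simp add: s_def sum.distrib sum_subtractf)
  also have "\<dots> \<le> \<eta>" using near[of I] img by simp
  finally have "(\<Sum>j\<in>I. s j) \<le> \<eta>" .
  moreover have i: "i \<in> I" using False by (simp add: I_def T_def)
  then have "s i \<le> (\<Sum>j\<in>I. s j)" using s0 by (intro member_le_sum) auto
  ultimately have "s i \<le> \<eta>" by simp
  then show ?thesis using mem[OF i] by (simp add: y s_def)
qed simp

text \<open>
  A vector in the space of one multi-circuit almost satisfies the maximality condition for every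
  multi-circuit that is maximal at a nearby parameter.  The weight comparison needed for
  complementary slackness on a set \<open>I\<close> of rows comes from the permutation that follows \<^term>\<open>p\<close> on \<open>I\<close>
  and \<^term>\<open>q\<close> elsewhere: it cannot beat \<^term>\<open>q\<close> at \<^term>\<open>k'\<close>, and moving the parameter to \<^term>\<open>k\<close> changes the
  comparison by at most \<open>n \<bar>k - k'\<bar>\<close>.
\<close>

lemma mc_space_near_optimal:
  fixes A :: "ereal ^ 'n::finite ^ 'n"
  assumes A: "A \<in> rmax_mat" and p: "perm_circuit A p V" and x: "x \<in> mc_space A (ereal k) (perm_edges p V)"
    and q: "perm_circuit A q U" and max: "maximal_mc A (ereal k') (perm_edges q U)"
    and near: "real CARD('n) * \<bar>k - k'\<bar> \<le> \<eta>"
  shows "mp_mult_vec A x $ i \<le> (if i \<in> U then A $ i $ q i else ereal k) + x $ q i + ereal \<eta>"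
proof -
  have k: "ereal k \<in> rmax" by (simp add: rmax_def)
  note row = mc_space_row[OF A k p x]
  define f where "f i = (if i \<in> V then real_of_ereal (A $ i $ p i) else k)" for i
  define g where "g i = (if i \<in> U then real_of_ereal (A $ i $ q i) else k)" for i
  have pV: "p permutes V" and qU: "q permutes U" using p q by (simp_all add: perm_circuit_def)
  have f: "(if i \<in> V then A $ i $ p i else ereal k) = ereal (f i)" for i
    using perm_circuit_entry[OF A p] by (simp add: f_def)
  have g: "(if i \<in> U then A $ i $ q i else ereal k) = ereal (g i)" for i
    using perm_circuit_entry[OF A q] by (simp add: g_def)
  have "ereal (f i) + x $ p i \<le> ereal (g i) + x $ q i + ereal \<eta>"
  proof (rule near_optimal_row_terms[where p = p and q = q and f = f and g = g and x = "($) x"])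
    show "bij p" "bij q" by (simp_all add: permutes_bij[OF pV] permutes_bij[OF qU])
    show "x $ j \<noteq> \<infinity>" for j using x by (simp add: mc_space_def rmax_vec_def rmax_def)
    show "ereal (g i) + x $ q i \<le> ereal (f i) + x $ p i" for i
    proof (cases "i \<in> U")
      case True
      have "A $ i $ q i + x $ q i \<le> mp_mult_vec A x $ i"
        by (auto simp: mp_mult_vec_def intro: SUP_upper2[of "q i"])
      then show ?thesis using True row(1)[of i] f[of i] g[of i] by simp
    next
      case False
      then show ?thesis
        using row[of i] f[of i] permutes_not_in[OF qU] by (simp add: g_def)
    qed
    show "(\<Sum>i\<in>I. f i) \<le> (\<Sum>i\<in>I. g i) + \<eta>" if I: "p ` I = q ` I" for I
    proof -
      \<comment> \<open>The exchange: \<open>p\<close> and \<open>q\<close> have the same image on \<open>I\<close>, so \<open>r\<close> is again a permutation.\<close>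
      define r where "r i = (if i \<in> I then p i else q i)" for i
      define W where "W = (I \<inter> V) \<union> (U - I)"
      have "r ` UNIV = p ` I \<union> q ` (- I)" by (auto simp: r_def)
      also have "\<dots> = q ` UNIV" unfolding I by blast
      also have "\<dots> = UNIV" by (rule bij_is_surj[OF permutes_bij[OF qU]])
      finally have "surj r" .
      then have "r permutes UNIV"
        by (intro bij_imp_permutes) (auto simp: finite_UNIV_surj_inj bij_def)
      then have rW: "r permutes W"
        by (rule permutes_superset)
          (use permutes_not_in[OF pV] permutes_not_in[OF qU] in \<open>auto simp: r_def W_def\<close>)
      then have r: "perm_circuit A r W"
        using p q by (auto simp: perm_circuit_def W_def r_def)
      have "circuit_value A k' r W \<le> circuit_value A k' q U"
        using real_maximal_optimal[OF A q r, of k'] max by (simp add: maximal_mc_def)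
      moreover have "circuit_value A k r W - circuit_value A k q U
          - (circuit_value A k' r W - circuit_value A k' q U)
          = (real (CARD('n) - card W) - real (CARD('n) - card U)) * (k - k')"
        by (simp add: circuit_value_eq algebra_simps)
      moreover have "\<dots> \<le> real CARD('n) * \<bar>k - k'\<bar>"
      proof -
        have "\<dots> \<le> \<bar>real (CARD('n) - card W) - real (CARD('n) - card U)\<bar> * \<bar>k - k'\<bar>"
          by (metis abs_ge_self abs_mult)
        also have "\<dots> \<le> real CARD('n) * \<bar>k - k'\<bar>"
          by (rule mult_right_mono) linarith+
        finally show ?thesis .
      qed
      ultimately have "circuit_value A k r W \<le> circuit_value A k q U + \<eta>"
        using near by linarith
      moreover have split: "(\<Sum>i\<in>UNIV. h i) = (\<Sum>i\<in>I. h i) + (\<Sum>i\<in>-I. h i)" for h :: "'n \<Rightarrow> real"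
        using sum.subset_diff[of I UNIV h] by (simp add: Compl_eq_Diff_UNIV)
      have "circuit_value A k r W = (\<Sum>i\<in>I. f i) + (\<Sum>i\<in>-I. g i)"
        unfolding circuit_value_def split
        by (intro arg_cong2[where f = "(+)"] sum.cong) (auto simp: W_def r_def f_def g_def)
      moreover have "circuit_value A k q U = (\<Sum>i\<in>I. g i) + (\<Sum>i\<in>-I. g i)"
        unfolding circuit_value_def split g_def ..
      ultimately show ?thesis by linarith
    qed
  qed
  then show ?thesis using row(1)[of i] f[of i] g[of i] by simp
qed

text \<open>
  If every row offers, besides the choice of the permutation \<^term>\<open>p\<close>, an alternative \<^term>\<open>s\<close>, then the
  alternatives contain a different permutation.  The map \<open>g = p\<^sup>-\<^sup>1 \<circ> s\<close> sends \<^term>\<open>S\<close> to itself, so it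
  permutes some nonempty subset \<open>U\<close>; there \<^term>\<open>s\<close> has the same image as \<^term>\<open>p\<close> and can
  replace it.
\<close>

lemma second_permutation:
  assumes fin: "finite S" and ne: "S \<noteq> {}" and p: "p ` S = S"
    and s: "\<And>i. i \<in> S \<Longrightarrow> s i \<in> S" "\<And>i. i \<in> S \<Longrightarrow> s i \<noteq> p i"
  obtains q i where "q ` S = S" "\<And>i. i \<in> S \<Longrightarrow> q i = p i \<or> q i = s i" "i \<in> S" "q i \<noteq> p i"
proof -
  define g where "g i = inv_into S p (s i)" for i
  have g: "g i \<in> S" "p (g i) = s i" if "i \<in> S" for i
    using s(1)[OF that] p by (auto simp: g_def inv_into_into f_inv_into_f)
  define P where "P U \<longleftrightarrow> U \<noteq> {} \<and> U \<subseteq> S \<and> g ` U \<subseteq> U" for U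
  have "P S" using ne g by (auto simp: P_def)
  from ex_has_least_nat[of P S card, OF this]
  obtain U where "P U" and min: "\<And>W. P W \<Longrightarrow> card U \<le> card W" by metis
  then have U: "U \<noteq> {}" "U \<subseteq> S" "g ` U \<subseteq> U" by (simp_all add: P_def)
  have finU: "finite U" using U fin finite_subset by blast
  have gU: "g ` U = U"
  proof (rule card_seteq[OF finU])
    show "g ` U \<subseteq> U" using U by blast
    have "P (g ` U)" using U unfolding P_def by blast
    then show "card U \<le> card (g ` U)" by (rule min)
  qed
  define q where "q i = (if i \<in> U then s i else p i)" for i
  have "s ` U = p ` g ` U"
    unfolding image_image by (rule image_cong) (use g(2) U in auto)
  then have "q ` U = p ` U" using gU by (simp add: q_def)
  moreover have "q ` (S - U) = p ` (S - U)" by (simp add: q_def)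
  moreover have "q ` S = q ` U \<union> q ` (S - U)" using U by blast
  ultimately have "q ` S = p ` U \<union> p ` (S - U)" by simp
  also have "\<dots> = S" using U p by blast
  finally have "q ` S = S" .
  moreover have "q i = p i \<or> q i = s i" for i by (simp add: q_def)
  moreover obtain i where "i \<in> U" using U by blast
  moreover from this have "i \<in> S" "q i \<noteq> p i" using U s(2) by (auto simp: q_def)
  ultimately show thesis by (intro that)
qed

section \<open>Sums of spaces at nearby parameters\<close>

lemma ereal_add_SUP:
  fixes c :: ereal
  assumes "K \<noteq> {}" "(SUP k\<in>K. f k) \<noteq> \<infinity>"
  shows "c + (SUP k\<in>K. f k) = (SUP k\<in>K. c + f k)"
proof (cases "c = -\<infinity>")
  case True
  have "f k \<noteq> \<infinity>" if "k \<in> K" for k using that assms(2) SUP_upper[of k K f] by auto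
  then have "(SUP k\<in>K. c + f k) = (SUP k\<in>K. -\<infinity>)"
    by (intro SUP_cong) (auto simp: True)
  then show ?thesis using assms True by simp
qed (simp add: SUP_ereal_add_right assms)

lemma mp_mult_vec_SUP_le:
  assumes K: "K \<noteq> {}" and u: "\<And>j. u $ j = (SUP k\<in>K. x k $ j)" "\<And>j. u $ j \<noteq> \<infinity>"
    and le: "\<And>k. k \<in> K \<Longrightarrow> mp_mult_vec A (x k) $ i \<le> b"
  shows "mp_mult_vec A u $ i \<le> b"
  unfolding mp_mult_vec_def vec_lambda_beta
proof (rule SUP_least)
  fix j
  have "A $ i $ j + u $ j = (SUP k\<in>K. A $ i $ j + x k $ j)"
    using ereal_add_SUP[OF K, of "\<lambda>k. x k $ j"] u by metis
  also have "\<dots> \<le> b"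
  proof (rule SUP_least)
    fix k assume "k \<in> K"
    have "A $ i $ j + x k $ j \<le> mp_mult_vec A (x k) $ i"
      by (auto simp: mp_mult_vec_def intro: SUP_upper2[of j])
    then show "A $ i $ j + x k $ j \<le> b" using le[OF \<open>k \<in> K\<close>] by (rule order_trans)
  qed
  finally show "A $ i $ j + u $ j \<le> b" .
qed

text \<open>
  This is the heart of the argument.  A sum \<^term>\<open>u\<close> of vectors from spaces at nearby parameters
  cannot have a set \<^term>\<open>S\<close> of rows whose maxima clearly exceed both the diagonal terms \<open>L + u\<^sub>i\<close> and all
  terms \<open>a\<^sub>i\<^sub>j + u\<^sub>j\<close> with \<^term>\<open>j\<close> outside \<^term>\<open>S\<close>.  By the near-optimality lemma every one of the
  multi-circuits attains these maxima up to \<^term>\<open>\<eta>\<close>, so it covers \<^term>\<open>S\<close> and maps \<^term>\<open>S\<close> to itself; by the star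
  property all of them agree on \<^term>\<open>S\<close> with one permutation \<open>P\<close>.  Every row of \<^term>\<open>S\<close> then attains its
  maximum along \<open>P\<close> and, the other candidates being too small, also at a second column in
  \<^term>\<open>S\<close>.  Alternating between the two choices gives another permutation of \<^term>\<open>S\<close> with the same
  weight, against the star property.
\<close>

lemma mp_sum_row_gap_contradiction:
  fixes A :: "ereal ^ 'n::finite ^ 'n" and \<eta> :: real
  assumes A: "A \<in> rmax_mat" and star: "star_property A"
    and K: "K \<noteq> {}" "K \<subseteq> rmax" and C: "\<And>k. k \<in> K \<Longrightarrow> maximal_mc A k (C k)"
    and u: "u \<in> mp_sum K (\<lambda>k. mc_space A k (C k))" "\<And>j. u $ j \<noteq> \<infinity>"
    and L: "\<And>k. k \<in> K \<Longrightarrow> k \<le> L" and \<eta>: "0 \<le> \<eta>"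
    and near: "\<And>k k'. k \<in> K \<Longrightarrow> k' \<in> K \<Longrightarrow> k \<noteq> k' \<Longrightarrow>
      \<exists>r r'. k = ereal r \<and> k' = ereal r' \<and> real CARD('n) * \<bar>r - r'\<bar> \<le> \<eta>"
    and S: "S \<noteq> {}" "\<And>i. i \<in> S \<Longrightarrow> u $ i \<noteq> -\<infinity>"
    and gap_diag: "\<And>i. i \<in> S \<Longrightarrow> L + u $ i + ereal \<eta> < mp_mult_vec A u $ i"
    and gap_out: "\<And>i j. i \<in> S \<Longrightarrow> j \<notin> S \<Longrightarrow> A $ i $ j + u $ j + ereal \<eta> < mp_mult_vec A u $ i"
  shows False
proof -
  obtain x where x: "\<And>k. k \<in> K \<Longrightarrow> x k \<in> mc_space A k (C k)" and ux: "u = (\<chi> i. SUP k\<in>K. x k $ i)"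
    using u(1) unfolding mp_sum_def by blast
  have uj: "u $ j = (SUP k\<in>K. x k $ j)" for j by (simp add: ux)
  have xu: "x k $ j \<le> u $ j" if "k \<in> K" for k j
    unfolding uj by (rule SUP_upper[OF that])
  have "\<exists>p V. perm_circuit A p V \<and> C k = perm_edges p V" if "k \<in> K" for k
    using C[OF that] multi_circuit_iff unfolding maximal_mc_def by blast
  then obtain p V where p: "\<And>k. k \<in> K \<Longrightarrow> perm_circuit A (p k) (V k)"
    and CV: "\<And>k. k \<in> K \<Longrightarrow> C k = perm_edges (p k) (V k)" by metis
  have max: "maximal_mc A k (perm_edges (p k) (V k))" if "k \<in> K" for k
    using C[OF that] CV[OF that] by simp
  have xs: "x k \<in> mc_space A k (perm_edges (p k) (V k))" if "k \<in> K" for k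
    using x[OF that] CV[OF that] by simp
  have rm: "k \<in> rmax" if "k \<in> K" for k using that K by blast
  have pV: "p k permutes V k" if "k \<in> K" for k using p[OF that] by (simp add: perm_circuit_def)
  note row = mc_space_row[OF A rm p xs]
  define R where "R i = mp_mult_vec A u $ i" for i
  have R_ge: "A $ i $ j + u $ j \<le> R i" for i j
    unfolding R_def by (auto simp: mp_mult_vec_def intro: SUP_upper2[of j])
  have R_le: "R i \<le> b" if "\<And>k. k \<in> K \<Longrightarrow> mp_mult_vec A (x k) $ i \<le> b" for i b
    unfolding R_def by (rule mp_mult_vec_SUP_le[OF K(1) uj u(2)]) (use that in auto)
  \<comment> \<open>Every multi-circuit \<open>C k\'\<close> nearly attains the row maxima of every summand \<open>x k\<close>.\<close>
  have cross: "mp_mult_vec A (x k) $ i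
      \<le> (if i \<in> V k' then A $ i $ p k' i else k) + x k $ p k' i + ereal \<eta>"
    if k: "k \<in> K" "k' \<in> K" for k k' i
  proof (cases "k = k'")
    case True
    have "mp_mult_vec A (x k) $ i + 0 \<le> mp_mult_vec A (x k) $ i + ereal \<eta>"
      by (rule add_left_mono) (use \<eta> in simp)
    then show ?thesis
      using row(1)[OF k(1) k(1) k(1), of i] unfolding True by (cases "i \<in> V k'") simp_all
  next
    case False
    then obtain r r' where r: "k = ereal r" "k' = ereal r'" "real CARD('n) * \<bar>r - r'\<bar> \<le> \<eta>"
      using near k by blast
    show ?thesis
      using mc_space_near_optimal[OF A p[OF k(1)] _ p[OF k(2)] _ r(3)] xs[OF k(1)] max[OF k(2)]
      unfolding r by simp
  qed
  have stay: "i \<in> V k \<and> p k i \<in> S" if k: "k \<in> K" and i: "i \<in> S" for k i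
  proof -
    have iV: "i \<in> V k"
    proof (rule ccontr)
      assume i': "i \<notin> V k"
      have "R i \<le> L + u $ i + ereal \<eta>"
      proof (rule R_le)
        fix k' assume k': "k' \<in> K"
        have "mp_mult_vec A (x k') $ i \<le> k' + x k' $ i + ereal \<eta>"
          using cross[OF k' k, of i] i' permutes_not_in[OF pV[OF k] i'] by simp
        also have "\<dots> \<le> L + u $ i + ereal \<eta>"
          by (intro add_mono L xu k' order_refl)
        finally show "mp_mult_vec A (x k') $ i \<le> L + u $ i + ereal \<eta>" .
      qed
      then show False using gap_diag[OF i] by (simp add: R_def)
    qed
    have "R i \<le> A $ i $ p k i + u $ p k i + ereal \<eta>"
    proof (rule R_le)
      fix k' assume k': "k' \<in> K"
      have "mp_mult_vec A (x k') $ i \<le> A $ i $ p k i + x k' $ p k i + ereal \<eta>"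
        using cross[OF k' k, of i] iV by simp
      also have "\<dots> \<le> A $ i $ p k i + u $ p k i + ereal \<eta>"
        by (intro add_mono xu k' order_refl)
      finally show "mp_mult_vec A (x k') $ i \<le> A $ i $ p k i + u $ p k i + ereal \<eta>" .
    qed
    then have "p k i \<in> S" using gap_out[OF i, of "p k i"] by (force simp: R_def)
    with iV show ?thesis ..
  qed
  have SV: "S \<subseteq> V k" if "k \<in> K" for k using stay[OF that] by blast
  have pS: "p k ` S = S" if "k \<in> K" for k
  proof (rule card_seteq)
    show "p k ` S \<subseteq> S" using stay[OF that] by blast
    show "card S \<le> card (p k ` S)"
      using card_image[OF inj_on_subset[OF permutes_inj[OF pV[OF that]] subset_UNIV]] by simp
  qed simp
  have fin: "A $ i $ p k i \<noteq> -\<infinity>" if "k \<in> K" "i \<in> S" for k i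
    using p[OF that(1)] SV[OF that(1)] that(2) by (auto simp: perm_circuit_def)
  have same: "p k i = p k' i" if k: "k \<in> K" "k' \<in> K" and i: "i \<in> S" for k k' i
  proof -
    let ?w = "\<lambda>k. \<Sum>i\<in>S. real_of_ereal (A $ i $ p k i)"
    have *: "p k' i = p k i" if k: "k \<in> K" "k' \<in> K" and "?w k \<le> ?w k'" for k k'
      using star_local_unique[OF A star rm p max SV pS pS, OF k(1) k(1) k(1) k(1) k(1) k(2)]
        fin[OF k(2)] that(3) i by blast
    show ?thesis using *[OF k] *[OF k(2,1)] by (metis linear)
  qed
  obtain k0 where k0: "k0 \<in> K" using K by blast
  define P where "P = p k0"
  have P: "p k i = P i" if "k \<in> K" "i \<in> S" for k i
    unfolding P_def using same k0 that by blast
  have PS: "P ` S = S" unfolding P_def by (rule pS[OF k0])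
  have rowP: "mp_mult_vec A (x k) $ i = A $ i $ P i + x k $ P i" if "k \<in> K" "i \<in> S" for k i
    using row(1)[OF that(1) that(1) that(1), of i] P[OF that] SV[OF that(1)] that(2) by auto
  have RP: "A $ i $ P i + u $ P i = R i" if i: "i \<in> S" for i
  proof (rule antisym[OF R_ge R_le])
    show "mp_mult_vec A (x k) $ i \<le> A $ i $ P i + u $ P i" if "k \<in> K" for k
      unfolding rowP[OF that i] by (intro add_left_mono xu that)
  qed
  have R_fin: "R i \<noteq> -\<infinity>" "R i \<noteq> \<infinity>" if "i \<in> S" for i
    using gap_diag[OF that] RP[OF that] rmax_mat_entry[OF A, of i "P i"] u(2)[of "P i"]
    by (auto simp: R_def)
  have drop: "a < R i" if "a + ereal \<eta> < R i" for a i
  proof -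
    have "a + 0 \<le> a + ereal \<eta>" by (rule add_left_mono) (use \<eta> in simp)
    then show ?thesis using that by simp
  qed
  have "\<exists>j\<in>S. j \<noteq> P i \<and> A $ i $ j + u $ j = R i" if i: "i \<in> S" for i
  proof (rule ccontr)
    assume no: "\<not> ?thesis"
    \<comment> \<open>The row maximum of each summand is attained off \<open>P\<close>, hence bounded by the finite set of
      candidates off \<open>P\<close> for \<open>u\<close>.  Infinitely many summands are allowed, so the bound is passed to the
      supremum instead of selecting a summand.\<close>
    define T where "T = insert (L + u $ i) ((\<lambda>j. A $ i $ j + u $ j) ` (-{P i}))"
    have T: "finite T" "T \<noteq> {}" by (simp_all add: T_def)
    have "A $ i $ j + u $ j < R i" if "j \<noteq> P i" for j
    proof (cases "j \<in> S")
      case True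
      then show ?thesis using no that R_ge[of i j] by (auto simp: less_le)
    next
      case False
      then show ?thesis using drop gap_out[OF i False] by (simp add: R_def)
    qed
    moreover have "L + u $ i < R i" using drop gap_diag[OF i] by (simp add: R_def)
    ultimately have "Max T < R i" using T by (auto simp: T_def)
    moreover have "R i \<le> Max T"
    proof (rule R_le)
      fix k assume k: "k \<in> K"
      have iV: "i \<in> V k" using SV[OF k] i by blast
      have "mp_mult_vec A (x k) $ i = A $ i $ p k i + x k $ p k i"
        using row(1)[OF k k k, of i] iV by simp
      also have "\<dots> = max (k + x k $ i) (SUP j\<in>-{p k i}. A $ i $ j + x k $ j)"
        by (rule mc_space_equations(1)[OF A rm[OF k] p[OF k] xs[OF k] iV])
      also have "\<dots> \<le> Max T"
      proof (rule max.boundedI)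
        have "k + x k $ i \<le> L + u $ i" by (intro add_mono L xu k)
        also have "\<dots> \<le> Max T" using T by (intro Max_ge) (auto simp: T_def)
        finally show "k + x k $ i \<le> Max T" .
        show "(SUP j\<in>-{p k i}. A $ i $ j + x k $ j) \<le> Max T"
        proof (rule SUP_least)
          fix j assume "j \<in> -{p k i}"
          then have j: "j \<in> -{P i}" using P[OF k i] by simp
          have "A $ i $ j + x k $ j \<le> A $ i $ j + u $ j" by (intro add_left_mono xu k)
          also have "\<dots> \<le> Max T" using T j by (intro Max_ge) (auto simp: T_def)
          finally show "A $ i $ j + x k $ j \<le> Max T" .
        qed
      qed
      finally show "mp_mult_vec A (x k) $ i \<le> Max T" .
    qed
    ultimately show False by simp
  qed
  then obtain s where s: "\<And>i. i \<in> S \<Longrightarrow> s i \<in> S" "\<And>i. i \<in> S \<Longrightarrow> s i \<noteq> P i"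
    and Rs: "\<And>i. i \<in> S \<Longrightarrow> A $ i $ s i + u $ s i = R i" by metis
  obtain q i where q: "q ` S = S" "\<And>i. i \<in> S \<Longrightarrow> q i = P i \<or> q i = s i" and i: "i \<in> S" "q i \<noteq> P i"
    by (rule second_permutation[OF finite S(1) PS s]) blast+
  have Rq: "A $ i $ q i + u $ q i = R i" if "i \<in> S" for i
    using q(2)[OF that] RP[OF that] Rs[OF that] by metis
  \<comment> \<open>Any permutation of \<open>S\<close> that attains all row maxima has the same weight: the sum of the maxima
    minus the sum of the entries of \<open>u\<close> on \<open>S\<close>.\<close>
  define y where "y j = real_of_ereal (u $ j)" for j
  have weight: "(\<Sum>i\<in>S. real_of_ereal (A $ i $ r i)) = (\<Sum>i\<in>S. real_of_ereal (R i)) - (\<Sum>i\<in>S. y i)"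
    if r: "r ` S = S" and Rr: "\<And>i. i \<in> S \<Longrightarrow> A $ i $ r i + u $ r i = R i" for r
  proof -
    have inj: "inj_on r S" using r by (simp add: eq_card_imp_inj_on)
    have "real_of_ereal (A $ i $ r i) = real_of_ereal (R i) - y (r i)" if "i \<in> S" for i
    proof -
      have "r i \<in> S" using r that by blast
      then show ?thesis
        using Rr[OF that] R_fin[OF that] S(2)[of "r i"] u(2)[of "r i"]
        by (cases "A $ i $ r i"; cases "u $ r i"; cases "R i") (auto simp: y_def)
    qed
    then have "(\<Sum>i\<in>S. real_of_ereal (A $ i $ r i)) = (\<Sum>i\<in>S. real_of_ereal (R i)) - (\<Sum>i\<in>S. y (r i))"
      by (simp add: sum_subtractf)
    also have "(\<Sum>i\<in>S. y (r i)) = (\<Sum>i\<in>S. y i)"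
      using sum.reindex[OF inj, of y] r by (simp add: o_def)
    finally show ?thesis .
  qed
  have "q i = p k0 i"
  proof (rule star_local_unique[OF A star rm[OF k0] p[OF k0] max[OF k0] SV[OF k0] pS[OF k0] q(1) _ _ i(1)])
    show "A $ i $ q i \<noteq> -\<infinity>" if "i \<in> S" for i
      using Rq[OF that] R_fin[OF that] u(2)[of "q i"] by (cases "u $ q i") auto
    show "(\<Sum>i\<in>S. real_of_ereal (A $ i $ p k0 i)) \<le> (\<Sum>i\<in>S. real_of_ereal (A $ i $ q i))"
      using weight[OF q(1) Rq] weight[OF PS RP] by (simp add: P_def)
  qed
  with i show False by (simp add: P_def)
qed

section \<open>Generic directions\<close>

lemma perturb_entry: "perturb A \<zeta> \<delta> $ i $ j = A $ i $ j - ereal (\<zeta> $ i $ j * \<delta>)"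
  by (simp add: perturb_def)

lemma perturb_rmax_mat: "A \<in> rmax_mat \<Longrightarrow> perturb A \<zeta> \<delta> \<in> rmax_mat"
  by (simp add: rmax_mat_def rmax_def perturb_entry ereal_minus_eq_PInfty_iff)

lemma perm_circuit_perturb [simp]: "perm_circuit (perturb A \<zeta> \<delta>) p V \<longleftrightarrow> perm_circuit A p V"
proof -
  have "a - ereal c = -\<infinity> \<longleftrightarrow> a = -\<infinity>" for a c by (cases a) auto
  then show ?thesis by (simp add: perm_circuit_def perturb_entry)
qed

lemma weight_perturb:
  fixes A :: "ereal ^ 'n::finite ^ 'n"
  assumes "A \<in> rmax_mat" "perm_circuit A p V"
  shows "(\<Sum>i\<in>V. real_of_ereal (perturb A \<zeta> \<delta> $ i $ p i))
    = (\<Sum>(i, j)\<in>perm_edges p V. real_of_ereal (A $ i $ j)) - (\<Sum>(i, j)\<in>perm_edges p V. \<zeta> $ i $ j) * \<delta>"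
proof -
  have "real_of_ereal (perturb A \<zeta> \<delta> $ i $ p i) = real_of_ereal (A $ i $ p i) - \<zeta> $ i $ p i * \<delta>"
    if "i \<in> V" for i
    unfolding perturb_entry by (subst perm_circuit_entry[OF assms that]) simp
  moreover have "(\<Sum>(i, j)\<in>perm_edges p V. h i j) = (\<Sum>i\<in>V. h i (p i))" for h :: "'n \<Rightarrow> 'n \<Rightarrow> real"
    unfolding perm_edges_def by (subst sum.reindex) (auto simp: inj_on_def)
  ultimately show ?thesis by (simp add: sum_subtractf sum_distrib_right)
qed

text \<open>
  Scaled distinct powers of two as entries: the sum over an edge set is then its binary code.
\<close>

lemma separating_direction:
  obtains \<zeta> :: "real ^ 'n::finite ^ 'n"
  where "\<And>i j. \<zeta> $ i $ j \<in> {0..1}" "inj (\<lambda>C. \<Sum>(i, j)\<in>C. \<zeta> $ i $ j)"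
proof -
  obtain e :: "'n \<times> 'n \<Rightarrow> nat" and N where e: "e ` UNIV = {i. i < N}" "inj e"
    using finite_imp_inj_to_nat_seg[OF finite_class.finite_UNIV] by blast
  define \<zeta> :: "real ^ 'n ^ 'n" where "\<zeta> = (\<chi> i j. 2 ^ e (i, j) / 2 ^ N)"
  have "\<zeta> $ i $ j \<in> {0..1}" for i j
  proof -
    have "e (i, j) < N" using e(1) by blast
    then have "(2::real) ^ e (i, j) \<le> 2 ^ N" by (intro power_increasing) auto
    then show ?thesis by (simp add: \<zeta>_def)
  qed
  moreover have sum: "(\<Sum>(i, j)\<in>C. \<zeta> $ i $ j) = real (set_encode (e ` C)) / 2 ^ N" for C
  proof -
    have "real (set_encode (e ` C)) = (\<Sum>c\<in>C. 2 ^ e c)"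
      unfolding set_encode_def
      by (subst sum.reindex[OF inj_on_subset[OF e(2) subset_UNIV]]) simp
    moreover have "(\<Sum>(i, j)\<in>C. \<zeta> $ i $ j) = (\<Sum>c\<in>C. 2 ^ e c / 2 ^ N)"
      by (rule sum.cong) (auto simp: \<zeta>_def)
    ultimately show ?thesis by (simp only: sum_divide_distrib)
  qed
  have "inj (\<lambda>C. \<Sum>(i, j)\<in>C. \<zeta> $ i $ j)"
  proof (rule injI)
    fix C D assume "(\<Sum>(i, j)\<in>C. \<zeta> $ i $ j) = (\<Sum>(i, j)\<in>D. \<zeta> $ i $ j)"
    then have "set_encode (e ` C) = set_encode (e ` D)" by (simp add: sum)
    then have "set_decode (set_encode (e ` C)) = set_decode (set_encode (e ` D))" by simp
    then have "e ` C = e ` D" by (simp only: set_encode_inverse[OF finite_imageI[OF finite]])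
    then show "C = D" using inj_image_eq_iff[OF e(2)] by blast
  qed
  ultimately show thesis using that by blast
qed

text \<open>
  The eigenspace is an intersection over all generic directions, so it would be the whole space
  without this lemma.  If the entries of \<open>\<zeta>\<close> have different sums over different edge sets, the
  perturbed weights of two edge sets are affine functions of \<open>\<delta>\<close> with different slopes; each pair
  agrees for at most one \<open>\<delta>\<close>, and there are finitely many pairs.
\<close>

lemma generic_dirs_nonempty:
  fixes A :: "ereal ^ 'n::finite ^ 'n"
  assumes A: "A \<in> rmax_mat"
  shows "generic_dirs A \<noteq> {}"
proof -
  obtain \<zeta> :: "real ^ 'n ^ 'n" where \<zeta>: "\<And>i j. \<zeta> $ i $ j \<in> {0..1}"
    and inj: "inj (\<lambda>C. \<Sum>(i, j)\<in>C. \<zeta> $ i $ j)"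
    by (rule separating_direction) blast
  define a where "a C = (\<Sum>(i, j)\<in>C. real_of_ereal (A $ i $ j))" for C
  define z where "z C = (\<Sum>(i, j)\<in>C. \<zeta> $ i $ j)" for C
  have "\<forall>\<^sub>F \<delta> in at_right 0. \<forall>C D. C \<noteq> D \<longrightarrow> a C - z C * \<delta> \<noteq> a D - z D * \<delta>"
  proof (intro eventually_all_finite)
    fix C D
    show "\<forall>\<^sub>F \<delta> in at_right 0. C \<noteq> D \<longrightarrow> a C - z C * \<delta> \<noteq> a D - z D * \<delta>"
      using eventually_neq_at_within[of "(a C - a D) / (z C - z D)" 0 "{0<..}"]
    proof eventually_elim
      case (elim \<delta>)
      show ?case
      proof
        assume "C \<noteq> D"
        then have "z C \<noteq> z D" using inj by (auto simp: z_def[abs_def] dest: injD)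
        then show "a C - z C * \<delta> \<noteq> a D - z D * \<delta>" using elim by (auto simp: field_simps)
      qed
    qed
  qed
  then obtain \<delta>' where \<delta>': "\<delta>' > 0"
    and neq: "\<And>\<delta> C D. 0 < \<delta> \<Longrightarrow> \<delta> < \<delta>' \<Longrightarrow> C \<noteq> D \<Longrightarrow> a C - z C * \<delta> \<noteq> a D - z D * \<delta>"
    unfolding eventually_at_right_field by metis
  have "star_property (perturb A \<zeta> \<delta>)" if \<delta>: "0 < \<delta>" "\<delta> < \<delta>'" for \<delta>
    unfolding star_property_def
  proof (intro ballI allI impI notI, elim conjE)
    fix l C D assume C: "maximal_mc (perturb A \<zeta> \<delta>) l C" and D: "maximal_mc (perturb A \<zeta> \<delta>) l D"
      and ne: "C \<noteq> D" and card: "card C = card D"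
    obtain p V where p: "perm_circuit (perturb A \<zeta> \<delta>) p V" and pC: "C = perm_edges p V"
      using C unfolding maximal_mc_def multi_circuit_iff by blast
    obtain q U where q: "perm_circuit (perturb A \<zeta> \<delta>) q U" and qD: "D = perm_edges q U"
      using D unfolding maximal_mc_def multi_circuit_iff by blast
    have VU: "card V = card U" using card by (simp add: pC qD card_perm_edges)
    have "(\<Sum>i\<in>V. real_of_ereal (perturb A \<zeta> \<delta> $ i $ p i)) = (\<Sum>i\<in>U. real_of_ereal (perturb A \<zeta> \<delta> $ i $ q i))"
      using maximal_same_length(1)[OF perturb_rmax_mat[OF A] p q C[unfolded pC] VU[symmetric]]
        maximal_same_length(1)[OF perturb_rmax_mat[OF A] q p D[unfolded qD] VU] by simp
    then have "a C - z C * \<delta> = a D - z D * \<delta>"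
      using weight_perturb[OF A] p q by (simp add: pC qD a_def z_def)
    then show False using neq[OF \<delta> ne] by blast
  qed
  then have "\<zeta> \<in> generic_dirs A" using \<zeta> \<delta>' unfolding generic_dirs_def by blast
  then show ?thesis by blast
qed

section \<open>Passage to the limit\<close>

lemma mp_mult_vec_attained:
  fixes A :: "ereal ^ 'n::finite ^ 'n"
  shows "\<exists>j. mp_mult_vec A x $ i = A $ i $ j + x $ j"
proof -
  let ?f = "\<lambda>j. A $ i $ j + x $ j"
  have "Sup (range ?f) \<in> range ?f" by (subst cSup_eq_Max) (auto intro!: Max_in)
  then show ?thesis by (auto simp: mp_mult_vec_def)
qed

text \<open>
  On \<open>W(A, k, C)\<close> one has \<open>A \<otimes> x \<ge> k \<otimes> x\<close>, and this inequality survives sums.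
\<close>

lemma mp_sum_row_ge:
  fixes A :: "ereal ^ 'n::finite ^ 'n"
  assumes A: "A \<in> rmax_mat" and K: "K \<noteq> {}" "K \<subseteq> rmax"
    and C: "\<And>k. k \<in> K \<Longrightarrow> multi_circuit A (C k)"
    and v: "v \<in> mp_sum K (\<lambda>k. mc_space A k (C k))" "v $ i \<noteq> \<infinity>"
    and m: "\<And>k. k \<in> K \<Longrightarrow> m \<le> k"
  shows "m + v $ i \<le> mp_mult_vec A v $ i"
proof -
  obtain x where x: "\<And>k. k \<in> K \<Longrightarrow> x k \<in> mc_space A k (C k)" and vx: "v = (\<chi> i. SUP k\<in>K. x k $ i)"
    using v(1) unfolding mp_sum_def by blast
  have xv: "x k $ j \<le> v $ j" if "k \<in> K" for k j
    unfolding vx vec_lambda_beta by (rule SUP_upper[OF that])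
  have "m + v $ i = (SUP k\<in>K. m + x k $ i)"
    using ereal_add_SUP[OF K(1), of "\<lambda>k. x k $ i" m] v(2) by (simp add: vx)
  also have "\<dots> \<le> mp_mult_vec A v $ i"
  proof (rule SUP_least)
    fix k assume k: "k \<in> K"
    obtain p V where p: "perm_circuit A p V" "C k = perm_edges p V"
      using C[OF k] multi_circuit_iff by blast
    have "m + x k $ i \<le> k + x k $ i" by (intro add_right_mono m k)
    also have "\<dots> \<le> mp_mult_vec A (x k) $ i"
      using mc_space_row(2)[OF A _ p(1)] x[OF k] p(2) k K(2) by auto
    also have "\<dots> \<le> mp_mult_vec A v $ i"
      unfolding mp_mult_vec_def vec_lambda_beta by (intro SUP_mono') (intro add_left_mono xv k)
    finally show "m + x k $ i \<le> mp_mult_vec A v $ i" .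
  qed
  finally show ?thesis .
qed

lemma eventually_less_limits:
  fixes f g :: "'a \<Rightarrow> ereal"
  assumes "(f \<longlongrightarrow> a) F" "(g \<longlongrightarrow> b) F" "a < b"
  shows "\<forall>\<^sub>F t in F. f t < g t"
proof -
  obtain c where c: "a < c" "c < b" using dense assms(3) by blast
  show ?thesis
    using order_tendstoD(2)[OF assms(1) c(1)] order_tendstoD(1)[OF assms(2) c(2)]
    by eventually_elim (rule less_trans)
qed

lemma tendsto_add_rmax:
  fixes f g :: "'a \<Rightarrow> ereal"
  assumes "(f \<longlongrightarrow> a) F" "(g \<longlongrightarrow> b) F" "a \<noteq> \<infinity>" "b \<noteq> \<infinity>"
  shows "((\<lambda>t. f t + g t) \<longlongrightarrow> a + b) F"
  using assms by (intro tendsto_add_ereal_general) auto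

lemma tendsto_perturb:
  "((\<lambda>\<delta>. perturb A \<zeta> \<delta> $ i $ j) \<longlongrightarrow> A $ i $ j) (at_right 0)"
proof -
  have "((\<lambda>\<delta>. ereal (- (\<zeta> $ i $ j * \<delta>))) \<longlongrightarrow> ereal (- (\<zeta> $ i $ j * 0))) (at_right 0)"
    by (intro tendsto_intros lim_ereal[THEN iffD2])
  then have "((\<lambda>\<delta>. A $ i $ j + ereal (- (\<zeta> $ i $ j * \<delta>))) \<longlongrightarrow> A $ i $ j + ereal (- (\<zeta> $ i $ j * 0))) (at_right 0)"
    by (intro tendsto_add_ereal_general1 tendsto_const) simp_all
  then show ?thesis by (simp add: perturb_entry minus_ereal_def)
qed

lemma tendsto_multiple:
  "((\<lambda>\<delta>. ereal (c * \<delta>)) \<longlongrightarrow> 0) (at_right 0)"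
proof -
  have "((\<lambda>\<delta>. ereal (c * \<delta>)) \<longlongrightarrow> ereal (c * 0)) (at_right 0)"
    by (intro tendsto_intros lim_ereal[THEN iffD2])
  then show ?thesis by (simp add: zero_ereal_def)
qed

lemma mp_ball_properties:
  assumes "l \<in> rmax" "0 \<le> r"
  shows "l \<in> mp_ball l r" "mp_ball l r \<subseteq> rmax" "k \<in> mp_ball l r \<Longrightarrow> k \<le> l + ereal r"
    "k \<in> mp_ball l r \<Longrightarrow> l - ereal r \<le> k"
  using assms by (cases l; auto simp: mp_ball_def rmax_def)+

lemma mp_ball_diameter:
  assumes "l \<in> rmax" "k \<in> mp_ball l r" "k' \<in> mp_ball l r" "k \<noteq> k'"
  shows "\<exists>s s'. k = ereal s \<and> k' = ereal s' \<and> \<bar>s - s'\<bar> \<le> 2 * r"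
  using assms by (cases l; cases k; cases k'; auto simp: mp_ball_def rmax_def)

text \<open>
  The larger eigenvalue \<^term>\<open>l2\<close> is used only through the inequality \<open>A \<otimes> x \<ge> l2 \<otimes> x\<close>, which passes to
  the limit.  On the support \<open>S\<close> of \<^term>\<open>x\<close> it gives row maxima strictly above \<open>l1 + x\<^sub>i\<close>, and trivially
  above the epsilon terms from outside \<open>S\<close>.  These strict inequalities between limits persist
  for the approximating sums near \<^term>\<open>l1\<close> at a small \<open>\<delta>\<close>, together with a slack \<open>2 n\<^sup>2 \<delta>\<close>; this is
  what \<open>mp_sum_row_gap_contradiction\<close> excludes.
\<close>

lemma limit_spaces_independent:
  fixes A :: "ereal ^ 'n::finite ^ 'n"
  assumes A: "A \<in> rmax_mat" and sel: "maximal_selection A C"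
    and l: "l1 \<in> rmax" "l2 \<in> rmax" "l1 < l2" and \<zeta>: "\<zeta> \<in> generic_dirs A"
    and x1: "x \<in> mp_limit (\<lambda>\<delta>. mp_sum (mp_ball l1 (real CARD('n) * \<delta>))
       (\<lambda>l'. mc_space (perturb A \<zeta> \<delta>) l' (C \<zeta> \<delta> l')))"
    and x2: "x \<in> mp_limit (\<lambda>\<delta>. mp_sum (mp_ball l2 (real CARD('n) * \<delta>))
       (\<lambda>l'. mc_space (perturb A \<zeta> \<delta>) l' (C \<zeta> \<delta> l')))"
  shows "x = eps_vec"
proof (rule ccontr)
  assume "x \<noteq> eps_vec"
  define S where "S = {i. x $ i \<noteq> -\<infinity>}"
  have S: "S \<noteq> {}"
    using \<open>x \<noteq> eps_vec\<close> unfolding S_def eps_vec_def vec_eq_iff by auto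
  define n where "n = real CARD('n)"
  define B where "B \<delta> = perturb A \<zeta> \<delta>" for \<delta>
  have n: "0 \<le> n" by (simp add: n_def)
  have B: "B \<delta> \<in> rmax_mat" for \<delta> using A by (simp add: B_def perturb_rmax_mat)
  have max: "maximal_mc (B \<delta>) k (C \<zeta> \<delta> k)" if "0 < \<delta>" "k \<in> rmax" for \<delta> k
    using sel \<zeta> that unfolding maximal_selection_def B_def by blast
  obtain u where u_in: "\<forall>\<^sub>F \<delta> in at_right 0. u \<delta> \<in> mp_sum (mp_ball l1 (n * \<delta>)) (\<lambda>k. mc_space (B \<delta>) k (C \<zeta> \<delta> k))"
    and u: "(u \<longlongrightarrow> x) (at_right 0)"
    using x1 unfolding mp_limit_def n_def B_def by blast
  obtain v where v_in: "\<forall>\<^sub>F \<delta> in at_right 0. v \<delta> \<in> mp_sum (mp_ball l2 (n * \<delta>)) (\<lambda>k. mc_space (B \<delta>) k (C \<zeta> \<delta> k))"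
    and v: "(v \<longlongrightarrow> x) (at_right 0)"
    using x2 unfolding mp_limit_def n_def B_def by blast
  have x: "x $ i \<noteq> \<infinity>" for i using x1 by (simp add: mp_limit_def rmax_vec_def rmax_def)
  have Aij: "A $ i $ j \<noteq> \<infinity>" for i j using rmax_mat_entry[OF A] .
  have l1: "l1 \<noteq> \<infinity>" and l2: "l2 \<noteq> \<infinity>" using l by (simp_all add: rmax_def)
  note ui = tendsto_vec_nth[OF u] and vi = tendsto_vec_nth[OF v]
  have Bij: "((\<lambda>\<delta>. B \<delta> $ i $ j) \<longlongrightarrow> A $ i $ j) (at_right 0)" for i j
    unfolding B_def by (rule tendsto_perturb)
  note pos = eventually_at_right_less[of "0::real"]
  \<comment> \<open>The inequality for the larger eigenvalue, with a column \<open>j\<close> attaining the row maximum.\<close>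
  have "\<exists>j. l2 + x $ i \<le> A $ i $ j + x $ j" for i
  proof (rule ccontr)
    assume "\<not> ?thesis"
    then have less: "A $ i $ j + x $ j < l2 + 0 + x $ i" for j by (simp add: not_le)
    have "\<forall>\<^sub>F \<delta> in at_right 0. \<forall>j. B \<delta> $ i $ j + v \<delta> $ j < l2 + ereal (- n * \<delta>) + v \<delta> $ i"
    proof (rule eventually_all_finite)
      fix j
      show "\<forall>\<^sub>F \<delta> in at_right 0. B \<delta> $ i $ j + v \<delta> $ j < l2 + ereal (- n * \<delta>) + v \<delta> $ i"
        by (rule eventually_less_limits[OF _ _ less[of j]])
          (intro tendsto_add_rmax Bij vi tendsto_const tendsto_multiple; use Aij x l2 in simp)+
    qed
    moreover have "\<forall>\<^sub>F \<delta> in at_right 0. v \<delta> $ i < \<infinity>"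
      by (rule order_tendstoD(2)[OF vi]) (use x in simp)
    ultimately have "\<forall>\<^sub>F \<delta> in at_right (0::real). False"
      using v_in pos
    proof eventually_elim
      case (elim \<delta>)
      have n\<delta>: "0 \<le> n * \<delta>" using elim n by simp
      note ball = mp_ball_properties[OF l(2) n\<delta>]
      have "(l2 - ereal (n * \<delta>)) + v \<delta> $ i \<le> mp_mult_vec (B \<delta>) (v \<delta>) $ i"
      proof (rule mp_sum_row_ge[OF B _ ball(2) _ elim(3)])
        show "mp_ball l2 (n * \<delta>) \<noteq> {}" using ball(1) by blast
        show "multi_circuit (B \<delta>) (C \<zeta> \<delta> k)" if "k \<in> mp_ball l2 (n * \<delta>)" for k
          using max[OF elim(4)] ball(2) that unfolding maximal_mc_def by blast
      qed (use ball(4) elim in auto)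
      moreover obtain j where "mp_mult_vec (B \<delta>) (v \<delta>) $ i = B \<delta> $ i $ j + v \<delta> $ j"
        using mp_mult_vec_attained by blast
      ultimately show False using elim(1) by (simp add: minus_ereal_def not_le[symmetric])
    qed
    then show False by simp
  qed
  then obtain J where J: "\<And>i. l2 + x $ i \<le> A $ i $ J i + x $ J i" by metis
  have gapS: "l1 + x $ i < A $ i $ J i + x $ J i" "-\<infinity> < A $ i $ J i + x $ J i" if "i \<in> S" for i
  proof -
    have "l1 + x $ i < l2 + x $ i"
      using that x[of i] l by (cases "x $ i"; cases l1; cases l2) (auto simp: S_def)
    then show "l1 + x $ i < A $ i $ J i + x $ J i" using J by (rule less_le_trans)
    then show "-\<infinity> < A $ i $ J i + x $ J i" by (rule le_less_trans[rotated]) simp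
  qed
  \<comment> \<open>Two parameters in the ball of radius \<open>n \<delta>\<close> differ by at most \<open>2 n \<delta>\<close>; multiplied by the size \<open>n\<close> this
    is the slack in the near-optimality lemma.\<close>
  have "\<forall>\<^sub>F \<delta> in at_right 0. \<forall>i\<in>S. l1 + ereal (n * \<delta>) + u \<delta> $ i + ereal (n * (2 * n) * \<delta>)
      < B \<delta> $ i $ J i + u \<delta> $ J i"
  proof (intro eventually_ball_finite ballI finite)
    fix i assume "i \<in> S"
    then have "l1 + 0 + x $ i + 0 < A $ i $ J i + x $ J i" using gapS by simp
    then show "\<forall>\<^sub>F \<delta> in at_right 0. l1 + ereal (n * \<delta>) + u \<delta> $ i + ereal (n * (2 * n) * \<delta>)
      < B \<delta> $ i $ J i + u \<delta> $ J i"
      by (rule eventually_less_limits[rotated 2])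
        (intro tendsto_add_rmax Bij ui tendsto_const tendsto_multiple; use Aij x l1 in simp)+
  qed
  moreover have "\<forall>\<^sub>F \<delta> in at_right 0. \<forall>i\<in>S. \<forall>j\<in>-S.
      B \<delta> $ i $ j + u \<delta> $ j + ereal (n * (2 * n) * \<delta>) < B \<delta> $ i $ J i + u \<delta> $ J i"
  proof (intro eventually_ball_finite ballI finite)
    fix i j assume "i \<in> S" "j \<in> -S"
    then have out: "A $ i $ j + x $ j + 0 = -\<infinity>"
      using Aij[of i j] by (cases "A $ i $ j") (auto simp: S_def)
    have "A $ i $ j + x $ j + 0 < A $ i $ J i + x $ J i"
      unfolding out by (rule gapS(2)[OF \<open>i \<in> S\<close>])
    then show "\<forall>\<^sub>F \<delta> in at_right 0.
      B \<delta> $ i $ j + u \<delta> $ j + ereal (n * (2 * n) * \<delta>) < B \<delta> $ i $ J i + u \<delta> $ J i"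
      by (rule eventually_less_limits[rotated 2])
        (intro tendsto_add_rmax Bij ui tendsto_const tendsto_multiple; use Aij x in simp)+
  qed
  moreover have "\<forall>\<^sub>F \<delta> in at_right 0. \<forall>i\<in>S. -\<infinity> < u \<delta> $ i"
    by (intro eventually_ball_finite ballI finite order_tendstoD(1)[OF ui]) (simp add: S_def)
  moreover have "\<forall>\<^sub>F \<delta> in at_right 0. \<forall>j. u \<delta> $ j < \<infinity>"
    by (intro eventually_all_finite order_tendstoD(2)[OF ui]) (simp add: x)
  moreover have "\<forall>\<^sub>F \<delta> in at_right 0. star_property (B \<delta>)"
    using \<zeta> unfolding generic_dirs_def eventually_at_right_field B_def by blast
  ultimately have "\<forall>\<^sub>F \<delta> in at_right (0::real). False"
    using u_in pos
  proof eventually_elim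
    case (elim \<delta>)
    have n\<delta>: "0 \<le> n * \<delta>" using elim n by simp
    note ball = mp_ball_properties[OF l(1) n\<delta>]
    have row: "B \<delta> $ i $ j + u \<delta> $ j \<le> mp_mult_vec (B \<delta>) (u \<delta>) $ i" for i j
      by (auto simp: mp_mult_vec_def intro: SUP_upper2[of j])
    show False
    proof (rule mp_sum_row_gap_contradiction[OF B elim(5) _ ball(2) max _ _ ball(3) _ _ S])
      show "u \<delta> \<in> mp_sum (mp_ball l1 (n * \<delta>)) (\<lambda>k. mc_space (B \<delta>) k (C \<zeta> \<delta> k))" by (rule elim(6))
      show "mp_ball l1 (n * \<delta>) \<noteq> {}" using ball(1) by blast
      show "0 \<le> n * (2 * n) * \<delta>" using elim n by simp
      show "\<exists>r r'. k = ereal r \<and> k' = ereal r' \<and> real CARD('n) * \<bar>r - r'\<bar> \<le> n * (2 * n) * \<delta>"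
        if "k \<in> mp_ball l1 (n * \<delta>)" "k' \<in> mp_ball l1 (n * \<delta>)" "k \<noteq> k'" for k k'
      proof -
        obtain r r' where r: "k = ereal r" "k' = ereal r'" "\<bar>r - r'\<bar> \<le> 2 * (n * \<delta>)"
          using mp_ball_diameter[OF l(1) \<open>k \<in> mp_ball l1 (n * \<delta>)\<close> \<open>k' \<in> mp_ball l1 (n * \<delta>)\<close> \<open>k \<noteq> k'\<close>]
          by blast
        have "n * \<bar>r - r'\<bar> \<le> n * (2 * (n * \<delta>))" using r(3) n by (rule mult_left_mono)
        then show ?thesis using r by (auto simp: n_def mult.assoc mult.left_commute)
      qed
      show "l1 + ereal (n * \<delta>) + u \<delta> $ i + ereal (n * (2 * n) * \<delta>) < mp_mult_vec (B \<delta>) (u \<delta>) $ i"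
        if "i \<in> S" for i
        using elim(1) that row[of i "J i"] by (blast intro: less_le_trans)
      show "B \<delta> $ i $ j + u \<delta> $ j + ereal (n * (2 * n) * \<delta>) < mp_mult_vec (B \<delta>) (u \<delta>) $ i"
        if "i \<in> S" "j \<notin> S" for i j
        using elim(2) that row[of i "J i"] by (blast intro: less_le_trans)
    qed (use elim ball(2) in \<open>auto simp: less_le\<close>)
  qed
  then show False by simp
qed

lemma eps_vec_mem_alg_eigenspace:
  fixes A :: "ereal ^ 'n::finite ^ 'n"
  assumes A: "A \<in> rmax_mat" and l: "l \<in> rmax"
  shows "eps_vec \<in> alg_eigenspace C A l"
proof -
  have bot: "mp_mult_vec M eps_vec = (eps_vec :: ereal ^ 'n)" if "\<And>i j. M $ i $ j \<noteq> \<infinity>" for M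
  proof -
    have *: "M $ i $ j + -\<infinity> = -\<infinity>" for i j using that[of i j] by (cases "M $ i $ j") auto
    show ?thesis
      unfolding mp_mult_vec_def eps_vec_def vec_lambda_beta * by simp
  qed
  have mem: "eps_vec \<in> mc_space (perturb A \<zeta> \<delta>) k D" if "k \<in> rmax" for \<zeta> \<delta> k D
  proof -
    have fin: "perturb A \<zeta> \<delta> $ i $ j \<noteq> \<infinity>" "k \<noteq> \<infinity>" for i j
      using rmax_mat_entry[OF perturb_rmax_mat[OF A]] that by (auto simp: rmax_def)
    have "mp_mult_vec (mp_add (mat_off (perturb A \<zeta> \<delta>) D) (mp_scale k (unit_on D))) eps_vec = eps_vec"
      by (rule bot) (use fin in \<open>simp add: mp_add_def mp_scale_def mat_off_def unit_on_def max_def\<close>)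
    moreover have "mp_mult_vec (mp_add (mat_on (perturb A \<zeta> \<delta>) D) (mp_scale k (unit_off D))) eps_vec = eps_vec"
      by (rule bot) (use fin in \<open>simp add: mp_add_def mp_scale_def mat_on_def unit_off_def max_def\<close>)
    ultimately show ?thesis
      by (simp add: mc_space_def rmax_vec_def eps_vec_def rmax_def)
  qed
  show ?thesis
    unfolding alg_eigenspace_def mp_limit_def
  proof (intro INT_I CollectI conjI exI[of _ "\<lambda>_. eps_vec"] tendsto_const)
    show "eps_vec \<in> rmax_vec" by (simp add: rmax_vec_def eps_vec_def rmax_def)
    show "\<forall>\<^sub>F \<delta> in at_right 0. eps_vec \<in> mp_sum (mp_ball l (real CARD('n) * \<delta>))
        (\<lambda>l'. mc_space (perturb A \<zeta> \<delta>) l' (C \<zeta> \<delta> l'))" for \<zeta>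
      using eventually_at_right_less[of "0::real"]
    proof eventually_elim
      case (elim \<delta>)
      then have r: "0 \<le> real CARD('n) * \<delta>" by simp
      note ball = mp_ball_properties[OF l r]
      have "mp_ball l (real CARD('n) * \<delta>) \<noteq> {}" using ball(1) by blast
      then have "eps_vec = (\<chi> i. SUP k\<in>mp_ball l (real CARD('n) * \<delta>). (eps_vec :: ereal ^ 'n) $ i)"
        by (simp add: vec_eq_iff)
      moreover have "\<forall>k\<in>mp_ball l (real CARD('n) * \<delta>).
          eps_vec \<in> mc_space (perturb A \<zeta> \<delta>) k (C \<zeta> \<delta> k)"
        using mem ball(2) by blast
      ultimately show ?case
        unfolding mp_sum_def by (intro CollectI exI[of _ "\<lambda>_. eps_vec"] conjI)
    qed
  qed
qed

theorem proposition3p2: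
  fixes A :: "ereal ^ 'n ^ 'n" and l1 l2 :: ereal and C :: "'n::finite mc_selection"
  assumes "A \<in> rmax_mat"
    and "maximal_selection A C"
    and "alg_eigenvalue A l1" and "alg_eigenvalue A l2" and "l1 \<noteq> l2"
  shows "alg_eigenspace C A l1 \<inter> alg_eigenspace C A l2 = {eps_vec}"
proof -
  have l: "l1 \<in> rmax" "l2 \<in> rmax"
    using assms(3,4) unfolding alg_eigenvalue_def mp_factorization_def by blast+
  obtain \<zeta> where \<zeta>: "\<zeta> \<in> generic_dirs A" using generic_dirs_nonempty[OF assms(1)] by blast
  have "x = eps_vec" if x: "x \<in> alg_eigenspace C A l1" "x \<in> alg_eigenspace C A l2" for x
  proof -
    note lim = x[unfolded alg_eigenspace_def, THEN INT_D, OF \<zeta>]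
    show ?thesis
    proof (cases "l1 < l2")
      case True
      then show ?thesis
        using limit_spaces_independent[OF assms(1,2) l _ \<zeta> lim] by blast
    next
      case False
      then have "l2 < l1" using assms(5) by simp
      then show ?thesis
        using limit_spaces_independent[OF assms(1,2) l(2,1) _ \<zeta> lim(2,1)] by blast
    qed
  qed
  then show ?thesis
    using eps_vec_mem_alg_eigenspace[OF assms(1)] l by blast
qed

end
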